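(* Let $F = F^{\times} \times \mathcal F(P)$ be a factorial monoid and $H \subset F$ a seminormal C-monoid with $H^{\times} = H \cap F^{\times}$ which is dense in $F$. Write $\mathcal C = \mathcal C(H,F)$, $\mathcal C^* = \mathcal C^*(H,F)$, and let $\mathsf E(\mathcal C) = \mathsf E(\mathcal C^* ) = \{e_0, \ldots, e_n\}$ (distinct), where $n \in \mathbb N$, $e_0 = [1]$ and $e_0 + \ldots + e_n = e_n$. For $i \in [0,n]$ let $\mathcal C_i = \mathcal C_{e_i}$ and $\mathcal C_i^* = \mathcal C^*_{e_i}$ be the constituent groups of $e_i$ in $\mathcal C$ resp. $\mathcal C^*$. Let $\mathcal C_H = \{[y] \mid y \in H\}$ and $\mathcal C_{F^{\times}}(H,F) = \{[\epsilon] \mid \epsilon \in F^{\times}\}$ (a group). Suppose that every class of $\mathcal C^*$ contains an element of $P$. For $i \in [0,n]$ let $\varphi_i \colon \mathcal C_{F^{\times}}(H,F) \to \mathcal C_i^*$, $\varphi_i([\epsilon]) = [\epsilon] + e_i$, and $\mathcal C_i' = \mathcal C_i^*/\varphi_i(\mathcal C_{F^{\times}}(H,F))$. For distinct $i,j \in [0,n]$ let $\phi_{i,j} \colon \mathcal C_i^* \to \mathcal C_i^* + \mathcal C_j^*$, $\phi_{i,j}(g) = g + e_j$. Then $H$ is half-factorial if and only if the following hold: (P1) $|\mathcal C_n'| \le 2$. (P2) For every $i \in [0,n]$: $\phi_{i,n}^{-1}\big(\varphi_n(\mathcal C_{F^{\times}}(H,F))\big) = \varphi_i(\mathcal C_{F^{\times}}(H,F))$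 if $e_i \in \mathcal C_H$, and $\phi_{i,n}^{-1}\big(\varphi_n(\mathcal C_{F^{\times}}(H,F))\big) = \mathcal C_i$ if $e_i \notin \mathcal C_H$. (P3) For distinct $i,j \in [0,n]$ with $e_i, e_j \in \mathcal C_H$: $\ker(\phi_{i,j} \circ \varphi_i) = \ker(\varphi_i) + \ker(\varphi_j)$ (kernels taken as subgroups of $\mathcal C_{F^{\times}}(H,F)$, i.e. the preimages of the identity elements $e_i+e_j$, $e_i$, $e_j$ respectively). (P4) $\mathsf E(\mathcal C^* ) \setminus \mathcal C_H$ is additively closed, and for distinct $i_1, i_2, j \in [0,n]$ with $e_{i_1}, e_{i_2} \in \mathcal C_H$, $e_j \in \mathsf E(\mathcal C^* ) \setminus \mathcal C_H$ and $e_{i_1} + e_{i_2} + e_j \in \mathcal C_H$, we have $e_{i_1} + e_j \in \mathcal C_H$ or $e_{i_2} + e_j \in \mathcal C_H$.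
   Context: All semigroups are commutative with identity; a monoid is a cancellative such semigroup; $H^{\times}$ is the unit group, $\mathsf q(H)$ the quotient group, and $[a,b]$ denotes the set of integers between $a$ and $b$. A factorial monoid is $F = F^{\times} \times \mathcal F(P)$ with $\mathcal F(P)$ the free abelian monoid on the set $P$ of primes; $\mathsf v_p$ is the $p$-adic exponent. For a submonoid $H \subset F$, $y \sim y'$ ($H$-equivalence) if for all $x \in F$: $xy \in H \iff xy' \in H$; $[y]$ is the class of $y$; $\mathcal C(H,F) = \{[y] \mid y \in F\}$ is the class semigroup (additive, identity $[1]$), $\mathcal C^*(H,F) = \{[y] \mid y \in (F\setminus F^{\times}) \cup \{1\}\}$ the reduced class semigroup; $\mathsf E(\cdot)$ denotes the set of idempotents. $H$ is a C-monoid (in $F$) if $H^{\times} = H \cap F^{\times}$ and $\mathcal C^*(H,F)$ is finite; $H$ is dense in $F$ if $\mathsf v_p(H)$ is a numerical monoid for every $p \in P$. $H$ is seminormal if every $x \in \mathsf q(H)$ with $x^n \in H$ for all sufficiently large $n$ lies in $H$. For an idempotent $e$ of a commutative semigroup $\mathcal C$, the constituent group is $\mathcal C_e = \{x \in \mathcal C \mid x+e = x \text{ and } x+y = e \text{ for some } y \in \mathcal C\}$. An atom of $H$ is a non-unit not a product of two non-units; $H$ is half-factorial if any two factorizations of an element of $H$ into atoms have the same number of factors (every element of a C-monoid has a factorization into atoms). *)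

theory Defs
  imports "HOL-Library.Multiset"
begin

text \<open>The factorial monoid F = F^x \<times> F(P): elements are pairs (unit, multiset of primes),
  the unit group F^x is an arbitrary abelian group written additively (type 'u),
  the primes form a set P of the type 'p; an element of F is a pair whose multiset
  is supported in P. Multiplication is componentwise.\<close>

type_synonym ('u,'p) fm = "'u \<times> 'p multiset"

definition fmul :: "('u::ab_group_add,'p) fm \<Rightarrow> ('u,'p) fm \<Rightarrow> ('u,'p) fm" where
  "fmul x y = (fst x + fst y, snd x + snd y)"

definition fone :: "('u::ab_group_add,'p) fm" where
  "fone = (0, {#})"

primrec fpow :: "('u::ab_group_add,'p) fm \<Rightarrow> nat \<Rightarrow> ('u,'p) fm" where
  "fpow x 0 = fone"
| "fpow x (Suc n) = fmul x (fpow x n)"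

definition fprod :: "('u::ab_group_add,'p) fm list \<Rightarrow> ('u,'p) fm" where
  "fprod xs = foldr fmul xs fone"

definition Fset :: "'p set \<Rightarrow> ('u::ab_group_add,'p) fm set" where
  "Fset P = {x. set_mset (snd x) \<subseteq> P}"

definition Funits :: "('u::ab_group_add,'p) fm set" where
  "Funits = {x. snd x = {#}}"

definition prime_el :: "'p \<Rightarrow> ('u::ab_group_add,'p) fm" where
  "prime_el p = (0, {#p#})"

definition vp :: "'p \<Rightarrow> ('u,'p) fm \<Rightarrow> nat" where
  "vp p x = count (snd x) p"

definition submonoid :: "'p set \<Rightarrow> ('u::ab_group_add,'p) fm set \<Rightarrow> bool" where
  "submonoid P H \<longleftrightarrow> H \<subseteq> Fset P \<and> fone \<in> H \<and> (\<forall>x\<in>H. \<forall>y\<in>H. fmul x y \<in> H)"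

definition munits :: "('u::ab_group_add,'p) fm set \<Rightarrow> ('u,'p) fm set" where
  "munits H = {x\<in>H. \<exists>y\<in>H. fmul x y = fone}"

definition Hequiv :: "'p set \<Rightarrow> ('u::ab_group_add,'p) fm set \<Rightarrow> ('u,'p) fm \<Rightarrow> ('u,'p) fm \<Rightarrow> bool" where
  "Hequiv P H y y' \<longleftrightarrow> (\<forall>x\<in>Fset P. fmul x y \<in> H \<longleftrightarrow> fmul x y' \<in> H)"

definition cls :: "'p set \<Rightarrow> ('u::ab_group_add,'p) fm set \<Rightarrow> ('u,'p) fm \<Rightarrow> ('u,'p) fm set" where
  "cls P H y = {y'\<in>Fset P. Hequiv P H y y'}"

definition ClassSG :: "'p set \<Rightarrow> ('u::ab_group_add,'p) fm set \<Rightarrow> ('u,'p) fm set set" where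
  "ClassSG P H = cls P H ` Fset P"

definition RedClassSG :: "'p set \<Rightarrow> ('u::ab_group_add,'p) fm set \<Rightarrow> ('u,'p) fm set set" where
  "RedClassSG P H = cls P H ` ((Fset P - Funits) \<union> {fone})"

definition cplus :: "'p set \<Rightarrow> ('u::ab_group_add,'p) fm set \<Rightarrow> ('u,'p) fm set \<Rightarrow> ('u,'p) fm set \<Rightarrow> ('u,'p) fm set" where
  "cplus P H A B = {z\<in>Fset P. \<exists>a\<in>A. \<exists>b\<in>B. Hequiv P H (fmul a b) z}"

primrec csum :: "'p set \<Rightarrow> ('u::ab_group_add,'p) fm set \<Rightarrow> (nat \<Rightarrow> ('u,'p) fm set) \<Rightarrow> nat \<Rightarrow> ('u,'p) fm set" where
  "csum P H e 0 = e 0"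
| "csum P H e (Suc k) = cplus P H (csum P H e k) (e (Suc k))"

definition idem :: "'p set \<Rightarrow> ('u::ab_group_add,'p) fm set \<Rightarrow> ('u,'p) fm set set \<Rightarrow> ('u,'p) fm set set" where
  "idem P H S = {c\<in>S. cplus P H c c = c}"

definition constituent :: "'p set \<Rightarrow> ('u::ab_group_add,'p) fm set \<Rightarrow> ('u,'p) fm set set \<Rightarrow> ('u,'p) fm set \<Rightarrow> ('u,'p) fm set set" where
  "constituent P H S e = {x\<in>S. cplus P H x e = x \<and> (\<exists>y\<in>S. cplus P H x y = e)}"

definition CH :: "'p set \<Rightarrow> ('u::ab_group_add,'p) fm set \<Rightarrow> ('u,'p) fm set set" where
  "CH P H = cls P H ` H"

definition CFu :: "'p set \<Rightarrow> ('u::ab_group_add,'p) fm set \<Rightarrow> ('u,'p) fm set set" where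
  "CFu P H = cls P H ` Funits"

definition phiImg :: "'p set \<Rightarrow> ('u::ab_group_add,'p) fm set \<Rightarrow> ('u,'p) fm set \<Rightarrow> ('u,'p) fm set set" where
  "phiImg P H e = (\<lambda>g. cplus P H g e) ` CFu P H"

definition phiKer :: "'p set \<Rightarrow> ('u::ab_group_add,'p) fm set \<Rightarrow> ('u,'p) fm set \<Rightarrow> ('u,'p) fm set set" where
  "phiKer P H e = {g\<in>CFu P H. cplus P H g e = e}"

definition C_monoid :: "'p set \<Rightarrow> ('u::ab_group_add,'p) fm set \<Rightarrow> bool" where
  "C_monoid P H \<longleftrightarrow> munits H = H \<inter> Funits \<and> finite (RedClassSG P H)"

definition numerical_monoid :: "nat set \<Rightarrow> bool" where
  "numerical_monoid S \<longleftrightarrow> 0 \<in> S \<and> (\<forall>a\<in>S. \<forall>b\<in>S. a + b \<in> S) \<and> finite (UNIV - S)"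

definition dense :: "'p set \<Rightarrow> ('u::ab_group_add,'p) fm set \<Rightarrow> bool" where
  "dense P H \<longleftrightarrow> (\<forall>p\<in>P. numerical_monoid (vp p ` H))"

text \<open>seminormal: x = a b^{-1} in q(H) (a, b in H) with x^n in H for all large n lies in H\<close>
definition seminormal :: "('u::ab_group_add,'p) fm set \<Rightarrow> bool" where
  "seminormal H \<longleftrightarrow> (\<forall>a\<in>H. \<forall>b\<in>H.
     (\<exists>N. \<forall>n\<ge>N. \<exists>h\<in>H. fpow a n = fmul h (fpow b n)) \<longrightarrow> (\<exists>h\<in>H. a = fmul h b))"

definition atom :: "('u::ab_group_add,'p) fm set \<Rightarrow> ('u,'p) fm \<Rightarrow> bool" where
  "atom H a \<longleftrightarrow> a \<in> H \<and> a \<notin> munits H \<and>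
     \<not> (\<exists>b\<in>H - munits H. \<exists>c\<in>H - munits H. a = fmul b c)"

definition half_factorial :: "('u::ab_group_add,'p) fm set \<Rightarrow> bool" where
  "half_factorial H \<longleftrightarrow> (\<forall>xs ys. (\<forall>x\<in>set xs. atom H x) \<and> (\<forall>y\<in>set ys. atom H y)
     \<and> fprod xs = fprod ys \<longrightarrow> length xs = length ys)"

end

theory Submission
  imports Defs "HOL-Library.Product_Plus"
begin

text \<open>
  A prime in the class of \<open>1\<close> shows that the reduced class semigroup is the whole class semigroup
  \<open>\<C>\<close>, which is therefore finite. Seminormality makes \<open>\<C>\<close> a union of groups, and then the
  classes of elements of \<open>H\<close> are idempotents; density puts the smallest idempotent \<open>e\<^sub>n\<close> among them.

  If one of (P1)--(P4) fails, primes in suitable classes give an element of \<open>H\<close> with two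
  factorizations of different lengths; for (P1), if \<open>x\<close>, \<open>y\<close> and \<open>x + y\<close> are all nonzero in
  \<open>\<C>\<^sub>n'\<close>, take primes \<open>p, q, s\<close> in classes \<open>x, y, - (x + y)\<close> and \<open>p', q', s'\<close> in the opposite
  classes and compare \<open>(p q s) (p' q' s') = (p p') (q q') (s s')\<close>.

  Conversely, give a prime whose idempotent is not in \<open>\<C>\<^sub>H\<close> the weight 0, and any other prime the
  weight 2 or 1 according to whether its class in \<open>\<C>\<^sub>n'\<close> is trivial or not. Under (P1)--(P4) every
  element of \<open>H\<close> of weight at least 4 splits in \<open>H\<close>, so that all atoms have weight 2.
\<close>

section \<open>The factorial monoid in additive notation\<close>

lemma fmul_eq_plus: "fmul = (+)"
  by (intro ext) (simp add: fmul_def plus_prod_def)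

lemma fone_eq_zero: "fone = 0"
  by (simp add: fone_def zero_prod_def)

lemma fprod_eq_sum_list: "fprod xs = sum_list xs"
  by (simp add: fprod_def fmul_eq_plus fone_eq_zero sum_list.eq_foldr)

lemma fpow_zero [simp]: "fpow x 0 = 0"
  and fpow_Suc: "fpow x (Suc n) = x + fpow x n"
  by (simp_all add: fmul_eq_plus fone_eq_zero)

declare fpow.simps [simp del]

lemma fpow_1 [simp]: "fpow x (Suc 0) = x"
  by (simp add: fpow_Suc)

lemma fpow_add: "fpow x (m + n) = fpow x m + fpow x n"
  by (induction m) (simp_all add: fpow_Suc add.assoc)

lemma fpow_plus: "fpow (x + y) n = fpow x n + fpow y n"
  by (induction n) (simp_all add: fpow_Suc ac_simps)

lemma fpow_mult: "fpow x (m * n) = fpow (fpow x m) n"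
  by (induction n) (simp_all add: fpow_Suc fpow_add)

definition unit_el :: "'u \<Rightarrow> ('u::ab_group_add, 'p) fm" where
  "unit_el u = (u, {#})"

lemma unit_el_add: "unit_el (u + v) = unit_el u + unit_el v"
  by (simp add: unit_el_def)

lemma unit_el_0 [simp]: "unit_el 0 = 0"
  by (simp add: unit_el_def zero_prod_def)

lemma unit_el_minus [simp]: "unit_el u + unit_el (- u) = 0" "unit_el (- u) + unit_el u = 0"
  by (simp_all flip: unit_el_add)

lemma unit_el_minus_left [simp]: "unit_el u + (unit_el (- u) + x) = x" "unit_el (- u) + (unit_el u + x) = x"
  by (simp_all flip: add.assoc)

text \<open>Used as a rewrite rule, this lists all splittings of an explicit multiset such as
  \<open>{#p, q, r#}\<close> into two parts; atoms built from a few primes are checked in this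
  way.\<close>

lemma add_mset_eq_plus_iff:
  "add_mset x M = A + B \<longleftrightarrow>
     (\<exists>A'. A = add_mset x A' \<and> M = A' + B) \<or> (\<exists>B'. B = add_mset x B' \<and> M = A + B')"
proof
  assume eq: "add_mset x M = A + B"
  then have "x \<in># A \<or> x \<in># B"
    by (metis union_iff union_single_eq_member)
  then show "(\<exists>A'. A = add_mset x A' \<and> M = A' + B) \<or> (\<exists>B'. B = add_mset x B' \<and> M = A + B')"
    using eq by (auto dest!: multi_member_split)
qed auto

lemma ball_Diff_single: "(\<forall>a\<in>A - {c}. Q a) \<longleftrightarrow> (\<forall>a\<in>A. a \<noteq> c \<longrightarrow> Q a)"
  by blast

lemma Funits_eq: "Funits = range unit_el"
  by (auto simp: Funits_def unit_el_def image_def)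

section \<open>Classes under H-equivalence\<close>

locale C_monoid_with_primes =
  fixes P :: "'p set" and H :: "('u::ab_group_add, 'p) fm set"
  assumes submonoid: "submonoid P H"
    and seminormal: "seminormal H"
    and C_monoid: "C_monoid P H"
    and dense: "dense P H"
    and primes: "\<forall>c\<in>RedClassSG P H. \<exists>p\<in>P. prime_el p \<in> c"
begin

abbreviation F :: "('u, 'p) fm set" where "F \<equiv> Fset P"

text \<open>Membership in F is built in, so that \<open>x \<approx> y\<close> alone entitles both
  sides to the rules for classes.\<close>

definition eqv :: "('u, 'p) fm \<Rightarrow> ('u, 'p) fm \<Rightarrow> bool" (infix "\<approx>" 50) where
  "x \<approx> y \<longleftrightarrow> x \<in> F \<and> y \<in> F \<and> Hequiv P H x y"

lemma add_in_F [simp]: "x + y \<in> F \<longleftrightarrow> x \<in> F \<and> y \<in> F"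
  by (auto simp: Fset_def)

lemma unit_in_F [simp]: "unit_el u \<in> F" and zero_in_F [simp]: "0 \<in> F"
  by (auto simp: Fset_def unit_el_def)

lemma prime_in_F [simp]: "prime_el p \<in> F \<longleftrightarrow> p \<in> P"
  by (auto simp: Fset_def prime_el_def)

lemma fpow_in_F [simp]: "x \<in> F \<Longrightarrow> fpow x n \<in> F"
  by (induction n) (auto simp: fpow_Suc)

lemma H_in_F [simp]: "x \<in> H \<Longrightarrow> x \<in> F"
  using submonoid by (auto simp: submonoid_def)

lemma zero_in_H [simp]: "0 \<in> H"
  and add_in_H: "x \<in> H \<Longrightarrow> y \<in> H \<Longrightarrow> x + y \<in> H"
  using submonoid by (auto simp: submonoid_def fmul_eq_plus fone_eq_zero)

lemma fpow_in_H: "x \<in> H \<Longrightarrow> fpow x n \<in> H"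
  by (induction n) (auto simp: fpow_Suc add_in_H)

lemma eqvI:
  "\<lbrakk>x \<in> F; y \<in> F; \<And>z. z \<in> F \<Longrightarrow> z + x \<in> H \<longleftrightarrow> z + y \<in> H\<rbrakk> \<Longrightarrow> x \<approx> y"
  by (auto simp: eqv_def Hequiv_def fmul_eq_plus)

lemma eqvD: "x \<approx> y \<Longrightarrow> z \<in> F \<Longrightarrow> z + x \<in> H \<longleftrightarrow> z + y \<in> H"
  by (auto simp: eqv_def Hequiv_def fmul_eq_plus)

lemma eqv_in_F: "x \<approx> y \<Longrightarrow> x \<in> F" "x \<approx> y \<Longrightarrow> y \<in> F"
  by (auto simp: eqv_def)

lemma eqv_refl [simp]: "x \<in> F \<Longrightarrow> x \<approx> x"
  by (auto simp: eqv_def Hequiv_def)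

lemma eqv_sym: "x \<approx> y \<Longrightarrow> y \<approx> x"
  by (auto simp: eqv_def Hequiv_def)

lemma eqv_trans [trans]: "x \<approx> y \<Longrightarrow> y \<approx> z \<Longrightarrow> x \<approx> z"
  by (auto simp: eqv_def Hequiv_def)

text \<open>Testing with the factor 1 shows that H is a union of classes.\<close>

lemma eqv_H: "x \<approx> y \<Longrightarrow> x \<in> H \<longleftrightarrow> y \<in> H"
  using eqvD[of x y 0] by simp

lemma eqv_add_left:
  assumes "x \<approx> y" "z \<in> F" shows "z + x \<approx> z + y"
proof (rule eqvI)
  fix w assume "w \<in> F"
  then show "w + (z + x) \<in> H \<longleftrightarrow> w + (z + y) \<in> H"
    using eqvD[OF assms(1), of "w + z"] assms(2) by (simp add: add.assoc)
qed (use assms eqv_in_F in auto)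

lemma eqv_add_right: "x \<approx> y \<Longrightarrow> z \<in> F \<Longrightarrow> x + z \<approx> y + z"
  using eqv_add_left by (simp add: add.commute)

lemma eqv_add: "x \<approx> y \<Longrightarrow> z \<approx> w \<Longrightarrow> x + z \<approx> y + w"
  by (meson eqv_add_left eqv_add_right eqv_in_F eqv_trans)

lemma eqv_fpow: "x \<approx> y \<Longrightarrow> fpow x n \<approx> fpow y n"
  by (induction n) (auto simp: fpow_Suc eqv_add)

lemma cls_eq_iff: "x \<in> F \<Longrightarrow> y \<in> F \<Longrightarrow> cls P H x = cls P H y \<longleftrightarrow> x \<approx> y"
  by (auto simp: cls_def eqv_def Hequiv_def)

text \<open>H-equivalence is a congruence, so the products of representatives all fall into one
  class, and closing them under equivalence gives the whole of it.\<close>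

lemma cplus_cls: 
  assumes "x \<in> F" "y \<in> F"
  shows "cplus P H (cls P H x) (cls P H y) = cls P H (x + y)"
proof -
  have *: "b \<in> cls P H a \<longleftrightarrow> a \<approx> b" if "a \<in> F" for a b
    using that by (auto simp: cls_def eqv_def)
  have "z \<in> cplus P H (cls P H x) (cls P H y) \<longleftrightarrow> x + y \<approx> z" for z
  proof
    assume "z \<in> cplus P H (cls P H x) (cls P H y)"
    then obtain a b where "z \<in> F" "a \<in> cls P H x" "b \<in> cls P H y" "Hequiv P H (a + b) z"
      unfolding cplus_def fmul_eq_plus by blast
    then have ab: "z \<in> F" "x \<approx> a" "y \<approx> b" "Hequiv P H (a + b) z"
      using assms by (simp_all add: *)
    then have "a + b \<approx> z"
      using eqv_in_F(2)[OF ab(2)] eqv_in_F(2)[OF ab(3)] unfolding eqv_def[of "a + b"] by simp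
    then show "x + y \<approx> z"
      by (rule eqv_trans[OF eqv_add[OF ab(2,3)]])
  next
    assume "x + y \<approx> z"
    then show "z \<in> cplus P H (cls P H x) (cls P H y)"
      unfolding cplus_def fmul_eq_plus using assms *[of x x] *[of y y] eqv_refl
      by (auto simp: eqv_def[of "x + y"])
  qed
  then show ?thesis
    using assms by (auto simp: *)
qed

lemma cls_in_CH_iff: "x \<in> F \<Longrightarrow> cls P H x \<in> CH P H \<longleftrightarrow> x \<in> H"
  unfolding CH_def using cls_eq_iff eqv_H H_in_F by blast

text \<open>Multiplying by a prime from the class of 1 turns any representative, units included,
  into a non-unit of the same class.\<close>

lemma RedClassSG_eq: "RedClassSG P H = ClassSG P H"
proof
  show "ClassSG P H \<subseteq> RedClassSG P H"
  proof
    fix c assume "c \<in> ClassSG P H"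
    then obtain x where x: "x \<in> F" "c = cls P H x"
      by (auto simp: ClassSG_def)
    have "cls P H fone \<in> RedClassSG P H"
      by (auto simp: RedClassSG_def)
    then obtain p where p: "p \<in> P" "prime_el p \<in> cls P H fone"
      using primes by blast
    then have "0 \<approx> prime_el p"
      by (auto simp: cls_def eqv_def fone_eq_zero)
    then have "x \<approx> prime_el p + x"
      using eqv_add_right[of 0 "prime_el p" x] x by simp
    then have "c = cls P H (prime_el p + x)"
      using x eqv_in_F cls_eq_iff by blast
    moreover have "prime_el p + x \<in> F - Funits"
      using p x by (auto simp: Funits_def prime_el_def simp del: add_in_F) (simp add: Fset_def)
    ultimately show "c \<in> RedClassSG P H"
      by (auto simp: RedClassSG_def)
  qed
qed (auto simp: RedClassSG_def ClassSG_def Fset_def fone_def)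

lemma finite_ClassSG: "finite (ClassSG P H)"
  using C_monoid RedClassSG_eq by (simp add: C_monoid_def)

lemma prime_representative:
  assumes "x \<in> F" obtains p where "p \<in> P" "prime_el p \<approx> x"
proof -
  have "cls P H x \<in> RedClassSG P H"
    using assms by (simp add: RedClassSG_eq ClassSG_def)
  then obtain p where "p \<in> P" "prime_el p \<in> cls P H x"
    using primes by blast
  then show ?thesis
    using assms that by (auto simp: cls_def eqv_def Hequiv_def)
qed

section \<open>Seminormality: the class semigroup is a union of groups\<close>

lemma seminormalD:
  assumes "b \<in> H" "z + b \<in> H" and pow: "\<And>n. n \<ge> m \<Longrightarrow> fpow z n \<in> H"
  shows "z \<in> H"
proof -
  have "\<exists>N. \<forall>n\<ge>N. \<exists>h\<in>H. fpow (z + b) n = fmul h (fpow b n)"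
    using pow by (auto simp: fpow_plus fmul_eq_plus)
  then obtain h where "h \<in> H" "z + b = h + b"
    using seminormal assms(1,2) unfolding seminormal_def fmul_eq_plus by blast
  then show ?thesis by simp
qed

text \<open>Pigeonhole: two powers of \<open>y\<close> share one of the finitely many classes, and
  multiplying both by further powers of \<open>y\<close> propagates the coincidence.\<close>

lemma fpow_periodic:
  assumes "y \<in> F"
  shows "\<exists>m k. k > 0 \<and> (\<forall>n\<ge>m. \<forall>j. fpow y (n + j * k) \<approx> fpow y n)"
proof -
  have "range (\<lambda>n. cls P H (fpow y n)) \<subseteq> ClassSG P H"
    using assms by (auto simp: ClassSG_def)
  then have "\<not> inj (\<lambda>n. cls P H (fpow y n))"
    using finite_subset[OF _ finite_ClassSG] finite_imageD[of _ UNIV] infinite_UNIV_nat by blast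
  then obtain a b where "a \<noteq> b" "cls P H (fpow y a) = cls P H (fpow y b)"
    by (auto simp: inj_def)
  then have "a \<noteq> b" "fpow y a \<approx> fpow y b" "fpow y b \<approx> fpow y a"
    using assms by (simp_all flip: cls_eq_iff)
  then obtain a b where ab: "a < b" "fpow y a \<approx> fpow y b"
    by (metis linorder_neqE_nat)
  define k where "k = b - a"
  have step: "fpow y (n + k) \<approx> fpow y n" if "n \<ge> a" for n
  proof -
    have "fpow y (n - a) + fpow y b \<approx> fpow y (n - a) + fpow y a"
      using eqv_add_left[OF eqv_sym[OF ab(2)]] assms by simp
    then show ?thesis
      using that ab(1) by (simp add: k_def flip: fpow_add)
  qed
  have "fpow y (n + j * k) \<approx> fpow y n" if "n \<ge> a" for n j
  proof (induction j)
    case (Suc j)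
    have "fpow y (n + Suc j * k) \<approx> fpow y (n + j * k)"
      using step[of "n + j * k"] that by (simp add: ac_simps)
    then show ?case
      using eqv_trans[OF _ Suc] by blast
  qed (use assms in auto)
  moreover have "k > 0"
    using ab(1) by (simp add: k_def)
  ultimately show ?thesis by blast
qed

text \<open>If the powers of \<open>y\<close> become periodic with period \<open>k\<close>, then \<open>x y\<close> and \<open>x y\<^bsup>k+1\<^esup>\<close> have
  equivalent large powers, so by seminormality either both or none of them lie in \<open>H\<close>.\<close>

lemma fpow_returns:
  assumes y: "y \<in> F" obtains k where "k > 0" "fpow y (Suc k) \<approx> y"
proof -
  obtain m k where k: "k > 0" and per: "\<And>n j. n \<ge> m \<Longrightarrow> fpow y (n + j * k) \<approx> fpow y n"
    using fpow_periodic[OF y] by blast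
  have "y \<approx> fpow y (Suc k)"
  proof (rule eqvI)
    fix x assume x: "x \<in> F"
    define z where "z = x + fpow y (Suc k)"
    define w where "w = x + y"
    have z_pow: "fpow z n \<approx> fpow w n" if "n \<ge> m" for n
      using eqv_add_left[OF per[OF that, of n], of "fpow x n"] x
      by (simp add: z_def w_def fpow_plus mult.commute flip: fpow_mult)
    \<comment> \<open>The factor \<open>fpow z m\<close> raises the exponent of \<open>y\<close>
      beyond \<open>m\<close>, where multiples of \<open>k\<close> may be dropped or added. If
      \<open>z\<close> is in H, this exhibits \<open>w\<close> as an element of the quotient group
      of H.\<close>
    have zw: "fpow z m + w \<approx> fpow z (Suc m)"
    proof -
      have "fpow z m + w = fpow x (Suc m) + fpow y (Suc m + m * k)"
        by (simp add: z_def w_def fpow_plus fpow_Suc fpow_add algebra_simps flip: fpow_mult)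
      also have "\<dots> \<approx> fpow x (Suc m) + fpow y (Suc m)"
        using x by (intro eqv_add_left per) auto
      also have "\<dots> \<approx> fpow x (Suc m) + fpow y (Suc m + Suc m * k)"
        using x by (intro eqv_add_left eqv_sym[OF per]) auto
      also have "\<dots> = fpow z (Suc m)"
        by (simp add: z_def fpow_plus algebra_simps flip: fpow_mult)
      finally show ?thesis .
    qed
    have wz: "fpow w m + z \<approx> fpow w (Suc m)"
    proof -
      have "fpow w m + z = fpow x (Suc m) + fpow y (Suc m + 1 * k)"
        by (simp add: z_def w_def fpow_plus fpow_Suc fpow_add algebra_simps)
      also have "\<dots> \<approx> fpow x (Suc m) + fpow y (Suc m)"
        using x by (intro eqv_add_left per) auto
      finally show ?thesis
        by (simp add: w_def fpow_plus)
    qed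
    have "z \<in> H" if "w \<in> H"
    proof (rule seminormalD[OF fpow_in_H[OF that]])
      show "z + fpow w m \<in> H"
        using eqv_H[OF wz] fpow_in_H[OF that] by (simp add: add.commute)
      show "fpow z n \<in> H" if "n \<ge> m" for n
        using eqv_H[OF z_pow[OF that]] fpow_in_H[OF \<open>w \<in> H\<close>] by simp
    qed
    moreover have "w \<in> H" if "z \<in> H"
    proof (rule seminormalD[OF fpow_in_H[OF that]])
      show "w + fpow z m \<in> H"
        using eqv_H[OF zw] fpow_in_H[OF that] by (simp add: add.commute)
      show "fpow w n \<in> H" if "n \<ge> m" for n
        using eqv_H[OF z_pow[OF that]] fpow_in_H[OF \<open>z \<in> H\<close>] by simp
    qed
    ultimately show "x + y \<in> H \<longleftrightarrow> x + fpow y (Suc k) \<in> H"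
      unfolding z_def w_def by blast
  qed (use y in auto)
  then show ?thesis
    using that k eqv_sym by blast
qed

lemma fpow_returns_mult:
  assumes "y \<in> F" "fpow y (Suc k) \<approx> y"
  shows "fpow y (Suc (k * j)) \<approx> y"
proof (induction j)
  case (Suc j)
  have "fpow y (Suc (k * Suc j)) = fpow y (k * j) + fpow y (Suc k)"
    by (simp add: add.commute flip: fpow_add)
  also have "\<dots> \<approx> fpow y (k * j) + y"
    using assms by (intro eqv_add_left) auto
  also have "\<dots> = fpow y (Suc (k * j))"
    by (simp add: fpow_Suc add.commute)
  finally show ?case
    using eqv_trans[OF _ Suc] by blast
qed (use assms in auto)

text \<open>Each class has its own period, and multiples of a period are periods; a product over the
  finitely many classes serves all elements at once.\<close>

lemma uniform_exponent:
  "\<exists>k\<ge>2. \<forall>y\<in>F. fpow y (Suc k) \<approx> y"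
proof -
  have "\<forall>c\<in>ClassSG P H. \<exists>k>0. \<forall>y\<in>F. cls P H y = c \<longrightarrow> fpow y (Suc k) \<approx> y"
  proof
    fix c assume "c \<in> ClassSG P H"
    then obtain x where x: "x \<in> F" "c = cls P H x"
      by (auto simp: ClassSG_def)
    then obtain k where k: "k > 0" "fpow x (Suc k) \<approx> x"
      using fpow_returns by blast
    have "fpow y (Suc k) \<approx> y" if "y \<in> F" "cls P H y = c" for y
      using k that x cls_eq_iff[of y x] eqv_fpow[of y x "Suc k"] by (meson eqv_sym eqv_trans)
    then show "\<exists>k>0. \<forall>y\<in>F. cls P H y = c \<longrightarrow> fpow y (Suc k) \<approx> y"
      using k by blast
  qed
  then obtain k where k: "\<And>c. c \<in> ClassSG P H \<Longrightarrow> k c > (0::nat)"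
    "\<And>y. y \<in> F \<Longrightarrow> fpow y (Suc (k (cls P H y))) \<approx> y"
    unfolding bchoice_iff by (auto simp: ClassSG_def)
  \<comment> \<open>The factor 2 ensures that \<open>K - 1\<close> is positive: inverses are then
    genuine powers, which stay in the constituent group of the element.\<close>
  define K where "K = 2 * prod k (ClassSG P H)"
  have "prod k (ClassSG P H) > 0"
    using k(1) by (simp add: prod_pos)
  moreover have "fpow y (Suc K) \<approx> y" if "y \<in> F" for y
  proof -
    have "k (cls P H y) dvd K"
      unfolding K_def using that finite_ClassSG by (auto intro!: dvd_mult dvd_prodI simp: ClassSG_def)
    then show ?thesis
      using fpow_returns_mult[OF that k(2)[OF that]] by (auto elim!: dvdE)
  qed
  ultimately show ?thesis
    by (intro exI[of _ K]) (auto simp: K_def)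
qed

definition K :: nat where
  "K = (SOME k. k \<ge> 2 \<and> (\<forall>y\<in>F. fpow y (Suc k) \<approx> y))"

lemma K: "K \<ge> 2" "y \<in> F \<Longrightarrow> fpow y (Suc K) \<approx> y"
  using someI_ex[OF uniform_exponent] unfolding K_def by blast+

text \<open>The class of \<open>ip x\<close> is the idempotent of the group containing the class of \<open>x\<close>, and in that
  group \<open>nv x\<close> represents the inverse.\<close>

definition ip :: "('u, 'p) fm \<Rightarrow> ('u, 'p) fm" where
  "ip x = fpow x K"

definition nv :: "('u, 'p) fm \<Rightarrow> ('u, 'p) fm" where
  "nv x = fpow x (K - 1)"

lemma ip_in_F [simp]: "x \<in> F \<Longrightarrow> ip x \<in> F" and nv_in_F [simp]: "x \<in> F \<Longrightarrow> nv x \<in> F"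
  by (auto simp: ip_def nv_def)

lemma ip_add: "ip (x + y) = ip x + ip y"
  by (simp add: ip_def fpow_plus)

lemma nv_add: "nv (x + y) = nv x + nv y"
  by (simp add: nv_def fpow_plus)

lemma eqv_ip: "x \<approx> y \<Longrightarrow> ip x \<approx> ip y"
  by (simp add: ip_def eqv_fpow)

lemma add_nv: "x + nv x = ip x"
  using K(1) by (simp add: nv_def ip_def flip: fpow_Suc)

lemma ip_add_self: "x \<in> F \<Longrightarrow> x + ip x \<approx> x"
  using K(2)[of x] by (simp add: ip_def fpow_Suc)

lemma ip_idem:
  assumes "x \<in> F" shows "ip x + ip x \<approx> ip x"
  using eqv_add_left[OF ip_add_self[OF assms], of "nv x"] assms
  by (simp add: add_nv add.commute[of "nv x"] flip: add.assoc)

lemma fpow_idem: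
  assumes "x + x \<approx> x" shows "fpow x (Suc n) \<approx> x"
proof (induction n)
  case 0
  show ?case using assms eqv_in_F by simp
next
  case (Suc n)
  have "x + fpow x (Suc n) \<approx> x + x"
    using Suc assms eqv_in_F by (intro eqv_add_left) auto
  then show ?case
    unfolding fpow_Suc[of x "Suc n"] using assms eqv_trans by blast
qed

lemma ip_of_idem: "x + x \<approx> x \<Longrightarrow> ip x \<approx> x"
  using fpow_idem[of x "K - 1"] K(1) by (simp add: ip_def)

lemma ip_ip: "x \<in> F \<Longrightarrow> ip (ip x) \<approx> ip x"
  by (simp add: ip_idem ip_of_idem)

lemma ip_nv:
  assumes "x \<in> F" shows "ip (nv x) \<approx> ip x"
proof -
  have "ip (nv x) = fpow (ip x) (Suc (K - 2))"
    using K(1) by (simp add: ip_def nv_def mult.commute Suc_diff_Suc numeral_2_eq_2 flip: fpow_mult)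
  then show ?thesis
    using fpow_idem[OF ip_idem[OF assms]] by simp
qed

text \<open>A unit is invertible in F and may be cancelled from \<open>ip_add_self\<close>; so the
  classes of units lie in the constituent group of the class of 1.\<close>

lemma ip_unit: "ip (unit_el u) \<approx> 0"
  using eqv_add_left[OF ip_add_self[of "unit_el u"], of "unit_el (- u)"]
  by simp

text \<open>Both \<open>y\<close> and \<open>nv y\<close> lie in H, and multiplying by them leads
  from \<open>z + ip y\<close> to \<open>z + y\<close> and back without leaving H.\<close>

lemma ip_eqv_of_H:
  assumes "y \<in> H" shows "ip y \<approx> y"
proof (rule eqvI)
  fix z assume z: "z \<in> F"
  have "z + ip y \<in> H" if "z + y \<in> H"
  proof -
    have "z + y + nv y \<in> H"
      using add_in_H[OF that fpow_in_H[OF assms]] by (simp add: nv_def)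
    then show ?thesis by (simp add: add.assoc add_nv)
  qed
  moreover have "z + y \<in> H" if "z + ip y \<in> H"
  proof -
    have "z + (y + ip y) \<in> H"
      using add_in_H[OF that assms] by (simp add: ac_simps)
    then show ?thesis
      using eqvD[OF ip_add_self z] assms by auto
  qed
  ultimately show "z + ip y \<in> H \<longleftrightarrow> z + y \<in> H" by blast
qed (use assms in auto)

lemma ip_in_H: "y \<in> H \<Longrightarrow> ip y \<in> H"
  using eqv_H ip_eqv_of_H by blast

lemma H_idem:
  assumes "y \<in> H" shows "y + y \<approx> y"
proof -
  have "y + y \<approx> y + ip y"
    using assms by (intro eqv_add_left eqv_sym[OF ip_eqv_of_H]) auto
  also have "\<dots> \<approx> y"
    using assms by (intro ip_add_self) auto
  finally show ?thesis .
qed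

lemma eqv_add_absorb:
  assumes "x \<approx> y" "y \<in> H" shows "x + y \<approx> y"
  using eqv_trans[OF eqv_add_right[OF assms(1)] H_idem] assms(2) by simp

text \<open>A product in H has an idempotent class, and a unit factor does not change the
  idempotent.\<close>

lemma unit_add_eqv_ip:
  assumes "x \<in> F" "unit_el u + x \<in> H" shows "unit_el u + x \<approx> ip x"
proof -
  have "unit_el u + x \<approx> ip (unit_el u) + ip x"
    using ip_eqv_of_H[OF assms(2)] eqv_sym by (simp add: ip_add)
  also have "\<dots> \<approx> 0 + ip x"
    using assms by (intro eqv_add_right ip_unit) auto
  finally show ?thesis by simp
qed

text \<open>If \<open>ip x \<in> H\<close>, then \<open>good x\<close> says that the class of \<open>x\<close> lies in the image of the unit
  classes in its constituent group.\<close>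

definition good :: "('u, 'p) fm \<Rightarrow> bool" where
  "good x \<longleftrightarrow> (\<exists>u. unit_el u + x \<in> H)"

lemma good_ip_in_H: "x \<in> F \<Longrightarrow> good x \<Longrightarrow> ip x \<in> H"
  using unit_add_eqv_ip eqv_H unfolding good_def by blast

lemma good_eqv: "x \<approx> y \<Longrightarrow> good x \<longleftrightarrow> good y"
  using eqvD by (auto simp: good_def)

lemma good_H: "x \<in> H \<Longrightarrow> good x"
  unfolding good_def by (rule exI[of _ 0]) simp

lemma good_add: "good x \<Longrightarrow> good y \<Longrightarrow> good (x + y)"
proof -
  assume "good x" "good y"
  then obtain u v where "unit_el u + x \<in> H" "unit_el v + y \<in> H"
    by (auto simp: good_def)
  then have "unit_el (u + v) + (x + y) \<in> H"
    using add_in_H by (fastforce simp: unit_el_add ac_simps)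
  then show ?thesis by (auto simp: good_def)
qed

text \<open>The assumption on \<open>ip x\<close> says that the idempotent of \<open>x\<close> acts
  as an identity on \<open>y\<close>. Since a unit turns \<open>x\<close> into this idempotent,
  \<open>x\<close> can be divided out.\<close>

lemma good_cancel:
  assumes "good x" "good (x + y)" "ip x + y \<approx> y" "x \<in> F"
  shows "good y"
proof -
  obtain u v where u: "unit_el u + x \<in> H" and v: "unit_el v + (x + y) \<in> H"
    using assms by (auto simp: good_def)
  have "unit_el (v - u) + y \<approx> unit_el (v - u) + (ip x + y)"
    using eqv_add_left[OF eqv_sym[OF assms(3)]] by simp
  also have "\<dots> \<approx> unit_el (v - u) + (unit_el u + x + y)"
    using eqv_sym[OF unit_add_eqv_ip[OF assms(4) u]] eqv_in_F(2)[OF assms(3)]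
    by (intro eqv_add_left eqv_add_right) simp_all
  also have "\<dots> = unit_el v + (x + y)"
    using unit_el_add[of "v - u" u, where ?'b = 'p] by (simp flip: add.assoc)
  finally show ?thesis
    using v eqv_H unfolding good_def by blast
qed

lemma good_nv:
  assumes "x \<in> F" "good (nv x)" shows "good x"
proof (rule good_cancel[of "nv x"])
  show "good (nv x + x)"
    using assms good_ip_in_H[of "nv x"] ip_nv[of x] eqv_H good_H by (simp add: add.commute add_nv)
  have "ip (nv x) + x \<approx> ip x + x"
    using assms by (intro eqv_add_right ip_nv)
  also have "\<dots> \<approx> x"
    using ip_add_self[OF assms(1)] by (simp add: add.commute)
  finally show "ip (nv x) + x \<approx> x" .
qed (use assms in auto)

section \<open>Atoms built from few primes\<close>

lemma atom_iff:
  "atom H a \<longleftrightarrow> a \<in> H \<and> snd a \<noteq> {#} \<and>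
     (\<forall>b\<in>H. \<forall>c\<in>H. a = b + c \<longrightarrow> snd b = {#} \<or> snd c = {#})"
proof -
  have "x \<in> munits H \<longleftrightarrow> x \<in> H \<and> snd x = {#}" for x
    using C_monoid by (auto simp: C_monoid_def Funits_def)
  then show ?thesis
    unfolding atom_def fmul_eq_plus by blast
qed

text \<open>Every factor in H has a good prime part, its own unit being the witness. So it suffices
  to rule out splittings of the multiset into two good parts, whatever units are attached.\<close>

lemma atomI:
  assumes H: "unit_el u + (0, M) \<in> H" and "M \<noteq> {#}"
    and split: "\<And>A B. \<lbrakk>M = A + B; A \<noteq> {#}; B \<noteq> {#}\<rbrakk> \<Longrightarrow> \<not> good (0, A) \<or> \<not> good (0, B)"
  shows "atom H (unit_el u + (0, M))"
  unfolding atom_iff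
proof (intro conjI ballI impI)
  show "snd (unit_el u + (0, M)) \<noteq> {#}"
    using assms by (simp add: unit_el_def)
  fix b c assume bc: "b \<in> H" "c \<in> H" "unit_el u + (0, M) = b + c"
  have good: "good (0, snd x)" if "x \<in> H" for x
    unfolding good_def using that by (intro exI[of _ "fst x"]) (simp add: unit_el_def)
  have "M = snd b + snd c"
    using bc(3) by (cases b; cases c) (simp add: unit_el_def)
  then show "snd b = {#} \<or> snd c = {#}"
    using split good bc by blast
qed (use assms in auto)

lemma atom_one_prime:
  assumes "unit_el u + prime_el p \<in> H" shows "atom H (unit_el u + prime_el p)"
  unfolding prime_el_def
  by (rule atomI) (use assms in \<open>auto simp: prime_el_def add_mset_eq_plus_iff\<close>)

lemma atom_two_primes:
  assumes "unit_el u + prime_el p + prime_el q \<in> H" "\<not> good (prime_el p) \<or> \<not> good (prime_el q)"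
  shows "atom H (unit_el u + prime_el p + prime_el q)"
proof -
  have "atom H (unit_el u + (0, {#p, q#}))"
    by (rule atomI) (use assms in \<open>auto simp: prime_el_def add_mset_eq_plus_iff add.assoc add_mset_commute\<close>)
  then show ?thesis
    by (simp add: prime_el_def add.assoc add_mset_commute)
qed

lemma atom_three_primes:
  assumes "unit_el u + prime_el p + prime_el q + prime_el r \<in> H"
    and "\<not> good (prime_el p) \<or> \<not> good (prime_el q + prime_el r)"
    and "\<not> good (prime_el q) \<or> \<not> good (prime_el p + prime_el r)"
    and "\<not> good (prime_el r) \<or> \<not> good (prime_el p + prime_el q)"
  shows "atom H (unit_el u + prime_el p + prime_el q + prime_el r)"
proof -
  have "atom H (unit_el u + (0, {#p, q, r#}))"
    by (rule atomI) (use assms in \<open>auto simp: prime_el_def add_mset_eq_plus_iff add.assoc add_mset_commute\<close>)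
  then show ?thesis
    by (simp add: prime_el_def add.assoc add_mset_commute)
qed

section \<open>Necessity of (P3) and (P4)\<close>

lemma half_factorialD:
  assumes "half_factorial H" "\<forall>x\<in>set xs. atom H x" "\<forall>y\<in>set ys. atom H y"
    and "sum_list xs = sum_list ys"
  shows "length xs = length ys"
  using assms unfolding half_factorial_def fprod_eq_sum_list by blast

lemma not_good_ip:
  assumes "x \<approx> y" "ip y \<notin> H" shows "\<not> good x"
  using assms good_eqv good_ip_in_H eqv_in_F by blast

text \<open>Take primes p, q in the classes of \<open>i\<close>, \<open>j\<close>. If the unit
  \<open>u\<close> cannot be distributed, then u p q and u^-1 p q are atoms whose product p p q q is
  also a product of four atoms.\<close>

lemma half_factorial_kernels:
  assumes hf: "half_factorial H" and ij: "i \<in> H" "j \<in> H" and u: "unit_el u + i + j \<in> H"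
  shows "\<exists>v. unit_el v + i \<in> H \<and> unit_el (u - v) + j \<in> H"
proof (rule ccontr)
  assume no_split: "\<not> ?thesis"
  obtain p where p: "p \<in> P" "prime_el p \<approx> i"
    using prime_representative[of i] ij by auto
  obtain q where q: "q \<in> P" "prime_el q \<approx> j"
    using prime_representative[of j] ij by auto
  \<comment> \<open>Both primes are good, so \<open>atomI\<close> does not apply: whether the
    element splits depends on how its unit can be shared between the two primes.\<close>
  have atom: "atom H (unit_el w + prime_el p + prime_el q)"
    if w: "unit_el w + i + j \<in> H" and ns: "\<nexists>v. unit_el v + i \<in> H \<and> unit_el (w - v) + j \<in> H" for w
    unfolding atom_iff
  proof (intro conjI ballI impI)
    have "unit_el w + prime_el p + prime_el q \<approx> unit_el w + i + j"
      using p q by (intro eqv_add) auto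
    then show "unit_el w + prime_el p + prime_el q \<in> H"
      using w eqv_H by blast
    show "snd (unit_el w + prime_el p + prime_el q) \<noteq> {#}"
      by (simp add: unit_el_def prime_el_def)
    fix b c assume bc: "b \<in> H" "c \<in> H" "unit_el w + prime_el p + prime_el q = b + c"
    have no: "False" if "b \<in> H" "c \<in> H" "snd b = {#p#}" "snd c = {#q#}" "fst b + fst c = w" for b c
    proof -
      have "b = unit_el (fst b) + prime_el p" "c = unit_el (w - fst b) + prime_el q"
        using that by (auto simp: unit_el_def prime_el_def prod_eq_iff)
      moreover have "unit_el (fst b) + prime_el p \<approx> unit_el (fst b) + i"
        "unit_el (w - fst b) + prime_el q \<approx> unit_el (w - fst b) + j"
        using p q by (auto intro: eqv_add_left)
      ultimately show False
        using ns that eqv_H by metis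
    qed
    have "{#p, q#} = snd b + snd c" "fst b + fst c = w"
      using bc(3) by (auto simp: unit_el_def prime_el_def prod_eq_iff add_mset_commute)
    then show "snd b = {#} \<or> snd c = {#}"
      using no[OF bc(1,2)] no[OF bc(2,1)] by (auto simp: add_mset_eq_plus_iff add.commute)
  qed
  \<comment> \<open>For \<open>z\<close> in H, the units that keep \<open>z\<close> in H are closed
    under inverses; this carries the failure from \<open>u\<close> over to
    \<open>- u\<close>.\<close>
  have *: "unit_el (- w) + z \<in> H" if "unit_el w + z \<in> H" "z \<in> H" for w z
  proof -
    have "unit_el w + z \<approx> z"
      using unit_add_eqv_ip[of z w] ip_eqv_of_H[of z] that eqv_trans by auto
    then have "unit_el (- w) + (unit_el w + z) \<approx> unit_el (- w) + z"
      by (intro eqv_add_left) auto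
    then show ?thesis
      using that eqv_H by simp
  qed
  have "\<nexists>v. unit_el v + i \<in> H \<and> unit_el (- u - v) + j \<in> H"
  proof
    assume "\<exists>v. unit_el v + i \<in> H \<and> unit_el (- u - v) + j \<in> H"
    then obtain v where "unit_el v + i \<in> H" "unit_el (- u - v) + j \<in> H" by blast
    then have "unit_el (- v) + i \<in> H" "unit_el (u - - v) + j \<in> H"
      using *[of v i] *[of "- u - v" j] ij by (auto simp: add.commute)
    then show False using no_split by blast
  qed
  then have "atom H (unit_el (- u) + prime_el p + prime_el q)"
    using atom[of "- u"] *[of u "i + j"] u ij add_in_H by (auto simp: add.assoc)
  moreover have "atom H (unit_el u + prime_el p + prime_el q)"
    using atom u no_split by blast
  moreover have "atom H (prime_el p)" "atom H (prime_el q)"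
    using atom_one_prime[of 0] eqv_H p q ij by auto
  ultimately show False
    using half_factorialD[OF hf, of "[unit_el u + prime_el p + prime_el q, unit_el (- u) + prime_el p + prime_el q]"
      "[prime_el p, prime_el p, prime_el q, prime_el q]"] by (simp add: ac_simps)
qed

text \<open>For primes p, q in the two idempotent classes, (p p q)(p q q) = (p q)(p q)(p q) would
  compare two atoms with three.\<close>

lemma half_factorial_idem_closed:
  assumes hf: "half_factorial H" and x: "x \<in> F" "ip x \<notin> H" and y: "y \<in> F" "ip y \<notin> H"
  shows "ip x + ip y \<notin> H"
proof
  assume xy: "ip x + ip y \<in> H"
  obtain p where p: "p \<in> P" "prime_el p \<approx> ip x"
    using prime_representative[of "ip x"] x by auto
  obtain q where q: "q \<in> P" "prime_el q \<approx> ip y"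
    using prime_representative[of "ip y"] y by auto
  have pp: "prime_el p + prime_el p \<approx> ip x" and qq: "prime_el q + prime_el q \<approx> ip y"
    using eqv_trans[OF eqv_add[OF p(2) p(2)] ip_idem] eqv_trans[OF eqv_add[OF q(2) q(2)] ip_idem] x y
    by auto
  have bad: "\<not> good (prime_el p)" "\<not> good (prime_el p + prime_el p)"
     "\<not> good (prime_el q)" "\<not> good (prime_el q + prime_el q)"
    using not_good_ip[OF p(2)] not_good_ip[OF pp] not_good_ip[OF q(2)] not_good_ip[OF qq]
      eqv_H[OF ip_ip] x y by auto
  have "atom H (prime_el p + prime_el q)"
    using atom_two_primes[of 0] eqv_H[OF eqv_add[OF p(2) q(2)]] xy bad by auto
  moreover have "atom H (prime_el p + prime_el p + prime_el q)"
    using atom_three_primes[of 0 p p q] eqv_H[OF eqv_add[OF pp q(2)]] xy bad by auto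
  moreover have "atom H (prime_el p + prime_el q + prime_el q)"
    using atom_three_primes[of 0 p q q] eqv_H[OF eqv_add[OF p(2) qq]] xy bad by (auto simp: add.assoc)
  ultimately show False
    using half_factorialD[OF hf, of "[prime_el p + prime_el p + prime_el q, prime_el p + prime_el q + prime_el q]"
      "[prime_el p + prime_el q, prime_el p + prime_el q, prime_el p + prime_el q]"] by (simp add: ac_simps)
qed

text \<open>For primes p, q, r in the classes of \<open>i\<close>, \<open>j\<close>,
  \<open>ip x\<close>, the identity (p q r r) p q = (p q r)(p q r) would compare three atoms with
  two.\<close>

lemma half_factorial_idem_absorb:
  assumes hf: "half_factorial H" and ij: "i \<in> H" "j \<in> H" and x: "x \<in> F" "ip x \<notin> H"
    and sum: "i + j + ip x \<in> H"
  shows "i + ip x \<in> H \<or> j + ip x \<in> H"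
proof (rule ccontr)
  assume neg: "\<not> ?thesis"
  obtain p where p: "p \<in> P" "prime_el p \<approx> i"
    using prime_representative[of i] ij by auto
  obtain q where q: "q \<in> P" "prime_el q \<approx> j"
    using prime_representative[of j] ij by auto
  obtain r where r: "r \<in> P" "prime_el r \<approx> ip x"
    using prime_representative[of "ip x"] x by auto
  have rr: "prime_el r + prime_el r \<approx> ip x"
    using eqv_trans[OF eqv_add[OF r(2) r(2)] ip_idem] x by auto
  \<comment> \<open>Here \<open>r'\<close> covers both r and r r, which lie in the same idempotent
    class.\<close>
  have bad: "\<not> good r'" "\<not> good (prime_el p + r')" "\<not> good (prime_el q + r')"
    if r': "r' \<approx> ip x" for r'
  proof -
    show "\<not> good r'"
      using not_good_ip[OF r'] eqv_H[OF ip_ip] x by auto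
    have *: "ip (k + ip x) \<approx> k + ip x" if "k \<in> H" for k
      unfolding ip_add using that x by (intro eqv_add ip_eqv_of_H ip_ip)
    show "\<not> good (prime_el p + r')"
      using not_good_ip[OF eqv_add[OF p(2) r']] eqv_H[OF *[OF ij(1)]] neg by auto
    show "\<not> good (prime_el q + r')"
      using not_good_ip[OF eqv_add[OF q(2) r']] eqv_H[OF *[OF ij(2)]] neg by auto
  qed
  note bad1 = bad[OF r(2)] and bad2 = bad[OF rr]
  have "atom H (prime_el p)" "atom H (prime_el q)"
    using atom_one_prime[of 0] eqv_H p q ij by auto
  moreover have "atom H (prime_el p + prime_el q + prime_el r)"
    using atom_three_primes[of 0 p q r] eqv_H[OF eqv_add[OF eqv_add[OF p(2) q(2)] r(2)]] sum bad1
    by auto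
  moreover have "atom H (unit_el 0 + (0, {#p, q, r, r#}))"
  proof (rule atomI)
    show "unit_el 0 + (0, {#p, q, r, r#}) \<in> H"
      using eqv_H[OF eqv_add[OF eqv_add[OF p(2) q(2)] rr]] sum
      by (simp add: prime_el_def add_mset_commute)
  qed (use bad1 bad2 in \<open>auto simp: prime_el_def add_mset_eq_plus_iff add_mset_commute\<close>)
  ultimately show False
    using half_factorialD[OF hf, of "[unit_el 0 + (0, {#p, q, r, r#}), prime_el p, prime_el q]"
      "[prime_el p + prime_el q + prime_el r, prime_el p + prime_el q + prime_el r]"] by (simp add: prime_el_def)
qed

section \<open>Idempotents, constituent groups and kernels through representatives\<close>

lemma idem_ClassSG_iff:
  "c \<in> idem P H (ClassSG P H) \<longleftrightarrow> (\<exists>x. x + x \<approx> x \<and> c = cls P H x)"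
proof
  assume "c \<in> idem P H (ClassSG P H)"
  then obtain x where "x \<in> F" "c = cls P H x" "cls P H (x + x) = cls P H x"
    by (auto simp: idem_def ClassSG_def cplus_cls)
  moreover from this have "x + x \<approx> x"
    by (simp add: cls_eq_iff)
  ultimately show "\<exists>x. x + x \<approx> x \<and> c = cls P H x" by blast
next
  assume "\<exists>x. x + x \<approx> x \<and> c = cls P H x"
  then obtain x where x: "x + x \<approx> x" "c = cls P H x" by blast
  moreover have "x \<in> F"
    using eqv_in_F(2)[OF x(1)] .
  ultimately show "c \<in> idem P H (ClassSG P H)"
    by (auto simp: idem_def ClassSG_def cplus_cls cls_eq_iff)
qed

text \<open>The right-hand side is the defining condition of the constituent group at
  \<open>i\<close>. In the order of idempotents, \<open>x + i \<approx> x\<close> puts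
  \<open>ip x\<close> below \<open>i\<close>, and \<open>x + y \<approx> i\<close> puts
  \<open>i\<close> below \<open>ip x\<close>.\<close>

lemma ip_eqv_iff:
  assumes i: "i + i \<approx> i" and x: "x \<in> F"
  shows "ip x \<approx> i \<longleftrightarrow> x + i \<approx> x \<and> (\<exists>y\<in>F. x + y \<approx> i)"
proof
  assume ip: "ip x \<approx> i"
  have "x + i \<approx> x + ip x"
    using eqv_add_left[OF eqv_sym[OF ip] x] .
  also have "\<dots> \<approx> x"
    using ip_add_self[OF x] .
  finally have "x + i \<approx> x" .
  moreover have "x + nv x \<approx> i"
    using ip by (simp add: add_nv)
  ultimately show "x + i \<approx> x \<and> (\<exists>y\<in>F. x + y \<approx> i)"
    using x nv_in_F by blast
next
  assume "x + i \<approx> x \<and> (\<exists>y\<in>F. x + y \<approx> i)"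
  then obtain y where xi: "x + i \<approx> x" and y: "y \<in> F" "x + y \<approx> i" by blast
  have ii: "ip i \<approx> i" and iF: "i \<in> F"
    using ip_of_idem[OF i] eqv_in_F(2)[OF i] by auto
  have xyi: "ip x + ip y \<approx> i"
    using eqv_trans[OF eqv_ip[OF y(2)] ii] by (simp add: ip_add)
  have "ip x \<approx> ip x + ip i"
    using eqv_sym[OF eqv_ip[OF xi]] by (simp add: ip_add)
  also have "\<dots> \<approx> ip x + i"
    using ii x by (intro eqv_add_left) auto
  also have "\<dots> \<approx> ip x + (ip x + ip y)"
    using eqv_add_left[OF eqv_sym[OF xyi]] x by auto
  also have "\<dots> \<approx> ip x + ip y"
    using eqv_add_right[OF ip_idem[OF x]] y by (simp flip: add.assoc)
  finally show "ip x \<approx> i"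
    using eqv_trans xyi by blast
qed

lemma constituent_eq:
  assumes i: "i + i \<approx> i"
  shows "constituent P H (ClassSG P H) (cls P H i) = cls P H ` {x \<in> F. ip x \<approx> i}"
proof -
  have iF: "i \<in> F"
    using eqv_in_F(2)[OF i] .
  have "cls P H x \<in> constituent P H (ClassSG P H) (cls P H i) \<longleftrightarrow> ip x \<approx> i" if x: "x \<in> F" for x
    using iF x by (simp add: constituent_def ClassSG_def cplus_cls cls_eq_iff ip_eqv_iff[OF i x])
  moreover have "constituent P H (ClassSG P H) (cls P H i) \<subseteq> cls P H ` F"
    by (auto simp: constituent_def ClassSG_def)
  ultimately show ?thesis by blast
qed

lemma CFu_eq: "CFu P H = range (\<lambda>u. cls P H (unit_el u))"
  unfolding CFu_def Funits_eq image_image ..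

lemma phiImg_eq: "i \<in> F \<Longrightarrow> phiImg P H (cls P H i) = range (\<lambda>u. cls P H (unit_el u + i))"
  by (simp add: phiImg_def CFu_eq image_image cplus_cls)

lemma ip_unit_add:
  assumes "x \<in> F" shows "ip (unit_el u + x) \<approx> ip x"
  using eqv_add_right[OF ip_unit, of "ip x" u] assms by (simp add: ip_add)

lemma unit_el_shift:
  assumes "unit_el u + x \<approx> y" shows "x \<approx> unit_el (- u) + y"
  using eqv_add_left[OF assms, of "unit_el (- u)"] by simp

text \<open>A translate of \<open>x\<close> by a unit lies in H only if its class is idempotent,
  hence that of \<open>i\<close>; translating back places \<open>x\<close> in the image.\<close>

lemma cls_in_phiImg_iff:
  assumes "i \<in> H" "x \<in> F" "ip x \<approx> i"
  shows "cls P H x \<in> phiImg P H (cls P H i) \<longleftrightarrow> good x"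
proof
  assume "cls P H x \<in> phiImg P H (cls P H i)"
  then obtain u where u: "x \<approx> unit_el u + i"
    using assms by (auto simp: phiImg_eq cls_eq_iff)
  have "i \<approx> unit_el (- u) + x"
    using unit_el_shift[OF eqv_sym[OF u]] .
  then show "good x"
    using assms(1) eqv_H unfolding good_def by blast
next
  assume "good x"
  then obtain u where u: "unit_el u + x \<in> H"
    by (auto simp: good_def)
  have "unit_el u + x \<approx> i"
    using eqv_trans[OF unit_add_eqv_ip[OF assms(2) u] assms(3)] .
  then have "x \<approx> unit_el (- u) + i"
    by (rule unit_el_shift)
  then show "cls P H x \<in> phiImg P H (cls P H i)"
    using assms by (auto simp: phiImg_eq cls_eq_iff)
qed

lemma phiImg_subset_constituent:
  assumes "i + i \<approx> i"
  shows "phiImg P H (cls P H i) \<subseteq> cls P H ` {x \<in> F. ip x \<approx> i}"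
proof -
  have "i \<in> F"
    using eqv_in_F(2)[OF assms] .
  then show ?thesis
    using eqv_trans[OF ip_unit_add ip_of_idem[OF assms]] by (auto simp: phiImg_eq)
qed

lemma unit_add_eqv_iff: "z \<in> H \<Longrightarrow> unit_el u + z \<approx> z \<longleftrightarrow> unit_el u + z \<in> H"
  using eqv_H[of "unit_el u + z" z] eqv_trans[OF unit_add_eqv_ip ip_eqv_of_H, of z u] by auto

text \<open>A unit fixes the class of an element of H exactly when their product stays in H, so all
  three kernels become conditions on units.\<close>

lemma kernel_sum_iff:
  assumes ij: "i \<in> H" "j \<in> H"
  shows "{g \<in> CFu P H. cplus P H (cplus P H g (cls P H i)) (cls P H j) = cplus P H (cls P H i) (cls P H j)}
      = {cplus P H a b | a b. a \<in> phiKer P H (cls P H i) \<and> b \<in> phiKer P H (cls P H j)}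
    \<longleftrightarrow> (\<forall>u. unit_el u + i + j \<in> H \<longrightarrow> (\<exists>v. unit_el v + i \<in> H \<and> unit_el (u - v) + j \<in> H))"
    (is "?L = ?R \<longleftrightarrow> ?rhs")
proof -
  have "cplus P H (cplus P H (cls P H (unit_el u)) (cls P H i)) (cls P H j)
      = cplus P H (cls P H i) (cls P H j) \<longleftrightarrow> unit_el u + i + j \<in> H" for u
    using ij unit_add_eqv_iff[OF add_in_H[OF ij]] by (simp add: cplus_cls cls_eq_iff add.assoc)
  then have L: "?L = {cls P H (unit_el u) | u. unit_el u + i + j \<in> H}"
    unfolding CFu_eq by blast
  have ker: "phiKer P H (cls P H k) = {cls P H (unit_el u) | u. unit_el u + k \<in> H}" if "k \<in> H" for k
  proof -
    have "cplus P H (cls P H (unit_el u)) (cls P H k) = cls P H k \<longleftrightarrow> unit_el u + k \<in> H" for u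
      using that unit_add_eqv_iff[OF that] by (simp add: cplus_cls cls_eq_iff)
    then show ?thesis
      unfolding phiKer_def CFu_eq by blast
  qed
  have add: "cls P H (unit_el (v + w)) = cplus P H (cls P H (unit_el v)) (cls P H (unit_el w))" for v w
    by (simp add: cplus_cls unit_el_add)
  have R: "?R = {cls P H (unit_el (v + w)) | v w. unit_el v + i \<in> H \<and> unit_el w + j \<in> H}"
    unfolding ker[OF ij(1)] ker[OF ij(2)] add by blast
  \<comment> \<open>This inclusion always holds, so the equality in (P3) amounts to the reverse
    one.\<close>
  have sub: "?R \<subseteq> ?L"
  proof
    fix c assume "c \<in> ?R"
    then obtain v w where vw: "c = cls P H (unit_el (v + w))" "unit_el v + i \<in> H" "unit_el w + j \<in> H"
      unfolding R by blast
    have "unit_el (v + w) + i + j \<in> H"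
      using add_in_H[OF vw(2,3)] by (simp add: unit_el_add ac_simps)
    then show "c \<in> ?L"
      unfolding L using vw(1) by blast
  qed
  have mem: "cls P H (unit_el u) \<in> ?R \<longleftrightarrow> (\<exists>v. unit_el v + i \<in> H \<and> unit_el (u - v) + j \<in> H)" for u
  proof
    assume "cls P H (unit_el u) \<in> ?R"
    then obtain v w where vw: "unit_el u \<approx> unit_el (v + w)" "unit_el v + i \<in> H" "unit_el w + j \<in> H"
      unfolding R by (auto simp: cls_eq_iff)
    \<comment> \<open>The sum \<open>v + w\<close> is only equivalent to \<open>u\<close>; replacing
      \<open>w\<close> by \<open>u - v\<close> makes the decomposition exact without leaving the
      class of \<open>w\<close>.\<close>
    have "unit_el (- v) + j + unit_el u \<approx> unit_el (- v) + j + unit_el (v + w)"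
      using ij by (intro eqv_add_left vw(1)) auto
    moreover have "unit_el (- v) + j + unit_el u = unit_el (u - v) + j"
      "unit_el (- v) + j + unit_el (v + w) = unit_el w + j"
      by (auto simp: unit_el_def prod_eq_iff)
    ultimately have "unit_el (u - v) + j \<in> H"
      using vw(3) eqv_H by metis
    then show "\<exists>v. unit_el v + i \<in> H \<and> unit_el (u - v) + j \<in> H"
      using vw(2) by blast
  next
    assume "\<exists>v. unit_el v + i \<in> H \<and> unit_el (u - v) + j \<in> H"
    then obtain v where "unit_el v + i \<in> H" "unit_el (u - v) + j \<in> H" by blast
    then show "cls P H (unit_el u) \<in> ?R"
      unfolding R by (intro CollectI exI[of _ v] exI[of _ "u - v"]) simp
  qed
  have "A = B \<longleftrightarrow> (\<forall>u. Q u \<longrightarrow> S u)"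
    if "B \<subseteq> A" "\<And>u. f u \<in> B \<longleftrightarrow> S u" "A = {f u | u. Q u}"
    for A B :: "('u, 'p) fm set set" and f and Q S :: "'u \<Rightarrow> bool"
    using that by blast
  from this[OF sub mem L] show ?thesis .
qed

text \<open>Adding an idempotent summand once more changes nothing. When the total is
  \<open>e n\<close>, this makes \<open>e n\<close> the smallest idempotent.\<close>

lemma csum_absorbs:
  assumes "\<forall>i\<le>k. e i \<in> idem P H (ClassSG P H)" "i \<le> k"
  shows "cplus P H (e i) (csum P H e k) = csum P H e k"
proof -
  have "\<forall>i. \<exists>x. i \<le> k \<longrightarrow> x + x \<approx> x \<and> e i = cls P H x"
    using assms(1) by (auto simp: idem_ClassSG_iff)
  then obtain r where r: "\<And>i. i \<le> k \<Longrightarrow> r i + r i \<approx> r i" "\<And>i. i \<le> k \<Longrightarrow> e i = cls P H (r i)"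
    by metis
  have rF: "r i \<in> F" if "i \<le> k" for i
    using eqv_in_F(2)[OF r(1)[OF that]] .
  have sumF: "sum r A \<in> F" if "\<And>i. i \<in> A \<Longrightarrow> i \<le> k" for A
    using that rF by (induction A rule: infinite_finite_induct) auto
  have csum: "csum P H e j = cls P H (sum r {..j})" if "j \<le> k" for j
    using that
  proof (induction j)
    case (Suc j)
    then show ?case
      using sumF[of "{..j}"] rF r(2) by (simp add: cplus_cls add.commute)
  qed (use r in auto)
  define t where "t = sum r ({..k} - {i})"
  have sum: "sum r {..k} = r i + t"
    unfolding t_def using assms(2) by (intro sum.remove) auto
  have "r i + r i + t \<approx> r i + t"
    using assms(2) by (intro eqv_add_right r(1)) (auto simp: t_def intro!: sumF)
  then show ?thesis
    using csum[of k] r(2)[OF assms(2)] rF[OF assms(2)] sumF[of "{..k}"] eqv_in_F[of "r i + r i + t" "r i + t"]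
    by (simp add: sum cplus_cls cls_eq_iff add.assoc)
qed

section \<open>The smallest idempotent\<close>

context
  fixes N :: "('u, 'p) fm"
  assumes N_idem: "N + N \<approx> N" and N_absorbs: "\<forall>x\<in>F. ip x + N \<approx> N"
begin

text \<open>\<open>N\<close> represents the smallest idempotent \<open>e\<^sub>n\<close>.\<close>

lemma ip_add_N: "x \<in> F \<Longrightarrow> ip x + N \<approx> N"
  using N_absorbs by blast

lemma N_in_F [simp]: "N \<in> F"
  using N_idem eqv_in_F by blast

text \<open>Density gives an element of H divisible by a prime from the class of \<open>N\<close>.
  Its idempotent lies below \<open>N\<close> and therefore equals it, and the idempotent of an
  element of H is again in H.\<close>

lemma N_in_H: "N \<in> H"
proof -
  obtain p where p: "p \<in> P" "prime_el p \<approx> N"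
    using prime_representative[OF N_in_F] by blast
  have "finite (UNIV - vp p ` H)"
    using dense p by (simp add: dense_def numerical_monoid_def)
  then have "vp p ` H \<noteq> {0}"
    using infinite_UNIV_nat by force
  moreover have "0 \<in> vp p ` H"
    by (rule image_eqI[OF _ zero_in_H]) (simp add: vp_def)
  ultimately obtain h where h: "h \<in> H" "vp p h \<noteq> 0"
    by blast
  define h' where "h' = (fst h, snd h - {#p#})"
  have eq: "h = prime_el p + h'"
    using h(2) by (simp add: h'_def prime_el_def vp_def prod_eq_iff)
  then have h': "h' \<in> F"
    using h(1) H_in_F[of h] by simp
  have "ip h = ip (prime_el p) + ip h'"
    by (simp add: eq ip_add)
  also have "\<dots> \<approx> ip N + ip h'"
    using p h' by (intro eqv_add_right eqv_ip) auto
  also have "\<dots> \<approx> N + ip h'"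
    using h' by (intro eqv_add_right ip_of_idem N_idem) auto
  also have "\<dots> \<approx> N"
    using ip_add_N[OF h'] by (simp add: add.commute)
  finally show ?thesis
    using ip_in_H[OF h(1)] eqv_H by blast
qed

lemma eqv_add_N: "a \<approx> x + N \<Longrightarrow> b \<approx> y + N \<Longrightarrow> a + b \<approx> x + y + N"
proof -
  assume ab: "a \<approx> x + N" "b \<approx> y + N"
  then have F: "x \<in> F" "y \<in> F"
    using eqv_in_F(2)[OF ab(1)] eqv_in_F(2)[OF ab(2)] by auto
  have "a + b \<approx> (x + y) + (N + N)"
    using eqv_add[OF ab] by (simp add: ac_simps)
  also have "\<dots> \<approx> x + y + N"
    using F by (intro eqv_add_left N_idem) auto
  finally show ?thesis .
qed

lemma eqv_ip_add_N: "a \<approx> ip x + N \<Longrightarrow> x \<in> F \<Longrightarrow> a \<approx> N"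
  using ip_add_N eqv_trans by blast

lemma ip_add_add_N:
  assumes "x \<in> F" "y \<in> F" shows "ip x + (y + N) \<approx> y + N"
  using eqv_add_left[OF ip_add_N[OF assms(1)] assms(2)] by (simp add: ac_simps)

text \<open>All idempotents act as the identity on the group of \<open>N\<close>, so good elements
  can be cancelled there.\<close>

lemma good_add_N_cancel:
  assumes "x \<in> F" "y \<in> F" "good (x + N)" "good (x + y + N)" shows "good (y + N)"
proof (rule good_cancel[of "x + N"])
  show "good (x + N + (y + N))"
    using good_eqv[OF eqv_add_N[of "x + N" x "y + N" y]] assms by simp
  show "ip (x + N) + (y + N) \<approx> y + N"
    using assms by (intro ip_add_add_N) auto
qed (use assms in auto)

lemma good_nv_N:
  assumes "x \<in> F" "good (nv x + N)" shows "good (x + N)"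
proof (rule good_add_N_cancel[of "nv x"])
  show "good (nv x + x + N)"
    using assms(1) good_eqv[OF ip_add_N] good_H[OF N_in_H] by (simp add: add.commute[of "nv x"] add_nv)
qed (use assms in auto)

section \<open>Necessity of (P1) and (P2)\<close>

lemma not_good_inverse_pair:
  assumes "x \<in> F" "\<not> good (x + N)"
  obtains p q where "p \<in> P" "q \<in> P" "prime_el p \<approx> x + N" "prime_el q \<approx> nv x + N"
    "\<not> good (prime_el p)" "\<not> good (prime_el q)" "prime_el p + prime_el q \<in> H"
proof -
  obtain p where p: "p \<in> P" "prime_el p \<approx> x + N"
    using prime_representative[of "x + N"] assms by auto
  obtain q where q: "q \<in> P" "prime_el q \<approx> nv x + N"
    using prime_representative[of "nv x + N"] assms by auto
  have "prime_el p + prime_el q \<approx> ip x + N"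
    using eqv_add_N[OF p(2) q(2)] by (simp add: add_nv)
  then have pq: "prime_el p + prime_el q \<in> H"
    using eqv_ip_add_N eqv_H N_in_H assms(1) by blast
  have bad: "\<not> good (prime_el p)"
    using good_eqv[OF p(2)] assms(2) by simp
  have "\<not> good (prime_el q)"
    using good_eqv[OF q(2)] good_nv_N[OF assms(1)] assms(2) by blast
  then show ?thesis
    using that p q pq bad by blast
qed

text \<open>The bound of (P1) is expressed without the quotient: two nontrivial cosets have trivial
  sum. Every splitting of three primes isolates one of them, and none of the six primes is good, so
  both triples are atoms.\<close>

lemma half_factorial_index_two:
  assumes hf: "half_factorial H" and x: "x \<in> F" "\<not> good (x + N)" and y: "y \<in> F" "\<not> good (y + N)"
  shows "good (x + y + N)"
proof (rule ccontr)
  assume "\<not> ?thesis"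
  then obtain t s where t: "t \<in> P" "s \<in> P" "prime_el t \<approx> x + y + N" "prime_el s \<approx> nv (x + y) + N"
    "\<not> good (prime_el t)" "\<not> good (prime_el s)" "prime_el t + prime_el s \<in> H"
    using not_good_inverse_pair[of "x + y"] x y by auto
  obtain p p' where p: "p \<in> P" "p' \<in> P" "prime_el p \<approx> x + N" "prime_el p' \<approx> nv x + N"
    "\<not> good (prime_el p)" "\<not> good (prime_el p')" "prime_el p + prime_el p' \<in> H"
    using not_good_inverse_pair[OF x] by blast
  obtain q q' where q: "q \<in> P" "q' \<in> P" "prime_el q \<approx> y + N" "prime_el q' \<approx> nv y + N"
    "\<not> good (prime_el q)" "\<not> good (prime_el q')" "prime_el q + prime_el q' \<in> H"
    using not_good_inverse_pair[OF y] by blast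
  have "prime_el p + prime_el q + prime_el s \<approx> ip (x + y) + N"
    using eqv_add_N[OF eqv_add_N[OF p(3) q(3)] t(4)] by (simp add: add_nv)
  then have 1: "prime_el p + prime_el q + prime_el s \<in> H"
    using eqv_ip_add_N eqv_H N_in_H x y by (metis add_in_F)
  have "prime_el p' + prime_el q' + prime_el t \<approx> nv x + nv y + (x + y) + N"
    using eqv_add_N[OF eqv_add_N[OF p(4) q(4)] t(3)] .
  also have "nv x + nv y + (x + y) + N = ip (x + y) + N"
    by (simp add: nv_add ac_simps flip: add_nv)
  finally have 2: "prime_el p' + prime_el q' + prime_el t \<in> H"
    using eqv_ip_add_N eqv_H N_in_H x y by (metis add_in_F)
  have "atom H (prime_el p + prime_el q + prime_el s)" "atom H (prime_el p' + prime_el q' + prime_el t)"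
    using atom_three_primes[of 0 p q s] atom_three_primes[of 0 p' q' t] 1 2 p q t by auto
  moreover have "atom H (prime_el p + prime_el p')" "atom H (prime_el q + prime_el q')"
    "atom H (prime_el t + prime_el s)"
    using atom_two_primes[of 0 p p'] atom_two_primes[of 0 q q'] atom_two_primes[of 0 t s] p q t by auto
  ultimately show False
    using half_factorialD[OF hf,
        of "[prime_el p + prime_el q + prime_el s, prime_el p' + prime_el q' + prime_el t]"
          "[prime_el p + prime_el p', prime_el q + prime_el q', prime_el t + prime_el s]"]
    by (simp add: ac_simps)
qed

text \<open>Take primes p, q, r in the classes of \<open>x\<close>, \<open>x + N\<close>,
  \<open>N\<close>, and a unit u that makes \<open>x + x + N\<close> an element of H. Then (u p p
  r)(u q q) = (u p q)(u p q) r; here p p is not good because \<open>ip x\<close> is outside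
  H.\<close>

lemma half_factorial_good_if_not_H:
  assumes hf: "half_factorial H" and x: "x \<in> F" "ip x \<notin> H"
  shows "good (x + N)"
proof (rule ccontr)
  assume bad: "\<not> ?thesis"
  obtain u where u: "unit_el u + (x + x + N) \<in> H"
    using half_factorial_index_two[OF hf x(1) bad x(1) bad] by (auto simp: good_def)
  obtain p where p: "p \<in> P" "prime_el p \<approx> x"
    using prime_representative[OF x(1)] by auto
  obtain q where q: "q \<in> P" "prime_el q \<approx> x + N"
    using prime_representative[of "x + N"] x by auto
  obtain r where r: "r \<in> P" "prime_el r \<approx> N"
    using prime_representative[OF N_in_F] by auto
  have bad_p: "\<not> good (prime_el p)"
    using not_good_ip[OF p(2) x(2)] .
  have bad_pp: "\<not> good (prime_el p + prime_el p)"
    using not_good_ip[OF eqv_add[OF p(2) p(2)]] eqv_H[OF ip_idem] x by (simp add: ip_add)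
  have bad_q: "\<not> good (prime_el q)"
    using good_eqv[OF q(2)] bad by simp
  have H: "unit_el u + w \<in> H" if "w \<approx> x + x + N" for w
    using eqv_H[OF eqv_add_left[OF that, of "unit_el u"]] u by simp
  have "atom H (unit_el u + prime_el p + prime_el p + prime_el r)"
    using atom_three_primes[of u p p r] H[OF eqv_add[OF eqv_add[OF p(2) p(2)] r(2)]] bad_p bad_pp
    by (auto simp: add.assoc)
  moreover have "atom H (unit_el u + prime_el q + prime_el q)"
    using atom_two_primes[of u q q] H[OF eqv_add_N[OF q(2) q(2)]] bad_q by (auto simp: add.assoc)
  moreover have "atom H (unit_el u + prime_el p + prime_el q)"
    using atom_two_primes[of u p q] H[of "prime_el p + prime_el q"] eqv_add[OF p(2) q(2)] bad_q
    by (auto simp: add.assoc)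
  moreover have "atom H (prime_el r)"
    using atom_one_prime[of 0 r] eqv_H[OF r(2)] N_in_H by simp
  ultimately show False
    using half_factorialD[OF hf, of "[unit_el u + prime_el p + prime_el p + prime_el r, unit_el u + prime_el q + prime_el q]"
      "[unit_el u + prime_el p + prime_el q, unit_el u + prime_el p + prime_el q, prime_el r]"] by (simp add: ac_simps)
qed

text \<open>Take primes p, q, r in the classes of \<open>x\<close>, \<open>nv x\<close>,
  \<open>N\<close>, and a unit u witnessing that \<open>x + N\<close> is good. If \<open>x\<close>
  were not good, (u p r)(u^-1 q r) = (p q) r r would compare two atoms with three.\<close>

lemma half_factorial_good_if_H:
  assumes hf: "half_factorial H" and x: "x \<in> F" "ip x \<in> H" "good (x + N)"
  shows "good x"
proof (rule ccontr)
  assume bad: "\<not> ?thesis"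
  obtain u where u: "unit_el u + (x + N) \<in> H"
    using x by (auto simp: good_def)
  obtain p where p: "p \<in> P" "prime_el p \<approx> x"
    using prime_representative[OF x(1)] by auto
  obtain q where q: "q \<in> P" "prime_el q \<approx> nv x"
    using prime_representative[of "nv x"] x by auto
  obtain r where r: "r \<in> P" "prime_el r \<approx> N"
    using prime_representative[OF N_in_F] by auto
  have bad_p: "\<not> good (prime_el p)" and bad_q: "\<not> good (prime_el q)"
    using good_eqv[OF p(2)] good_eqv[OF q(2)] good_nv[OF x(1)] bad by auto
  have "unit_el u + (x + N) \<approx> N"
  proof -
    have "unit_el u + (x + N) \<approx> ip x + ip N"
      using unit_add_eqv_ip[OF _ u] x by (simp add: ip_add)
    also have "\<dots> \<approx> ip x + N"
      using x by (intro eqv_add_left ip_of_idem N_idem) auto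
    also have "\<dots> \<approx> N"
      using x by (intro ip_add_N)
    finally show ?thesis .
  qed
  \<comment> \<open>Adding \<open>unit_el (- u) + nv x\<close> to both sides turns the left one into
    \<open>ip x + N\<close>, which lies in H; this puts the second triple into H.\<close>
  then have "unit_el (- u) + nv x + (unit_el u + (x + N)) \<approx> unit_el (- u) + nv x + N"
    using x by (intro eqv_add_left) auto
  moreover have "unit_el (- u) + nv x + (unit_el u + (x + N)) = (unit_el (- u) + unit_el u) + (x + nv x) + N"
    by (simp only: ac_simps)
  ultimately have "ip x + N \<approx> unit_el (- u) + nv x + N"
    by (simp add: add_nv)
  then have nu: "unit_el (- u) + nv x + N \<in> H"
    using eqv_H add_in_H[OF x(2) N_in_H] by blast
  have "atom H (unit_el u + prime_el p + prime_el r)"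
    using atom_two_primes[of u p r] eqv_H[OF eqv_add_left[OF eqv_add[OF p(2) r(2)], of "unit_el u"]] u bad_p
    by (auto simp: add.assoc)
  moreover have "atom H (unit_el (- u) + prime_el q + prime_el r)"
    using atom_two_primes[of "- u" q r] eqv_H[OF eqv_add_left[OF eqv_add[OF q(2) r(2)], of "unit_el (- u)"]] nu bad_q
    by (auto simp: add.assoc)
  moreover have "atom H (prime_el p + prime_el q)"
    using atom_two_primes[of 0 p q] eqv_H[OF eqv_add[OF p(2) q(2)]] x bad_q by (simp add: add_nv)
  moreover have "atom H (prime_el r)"
    using atom_one_prime[of 0 r] eqv_H[OF r(2)] N_in_H by simp
  ultimately show False
    using half_factorialD[OF hf, of "[unit_el u + prime_el p + prime_el r, unit_el (- u) + prime_el q + prime_el r]"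
      "[prime_el p + prime_el q, prime_el r, prime_el r]"] by (simp add: ac_simps)
qed

section \<open>Sufficiency: every atom has weight 2\<close>

context
  assumes index_two:
    "\<And>x y. \<lbrakk>x \<in> F; y \<in> F; \<not> good (x + N); \<not> good (y + N)\<rbrakk> \<Longrightarrow> good (x + y + N)"
    and good_if_H: "\<And>x. \<lbrakk>x \<in> F; ip x \<in> H; good (x + N)\<rbrakk> \<Longrightarrow> good x"
    and good_if_not_H: "\<And>x. \<lbrakk>x \<in> F; ip x \<notin> H\<rbrakk> \<Longrightarrow> good (x + N)"
    and kernels: "\<And>i j u. \<lbrakk>i \<in> H; j \<in> H; unit_el u + i + j \<in> H\<rbrakk>
      \<Longrightarrow> \<exists>v. unit_el v + i \<in> H \<and> unit_el (u - v) + j \<in> H"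
    and idem_closed:
    "\<And>x y. \<lbrakk>x \<in> F; ip x \<notin> H; y \<in> F; ip y \<notin> H\<rbrakk> \<Longrightarrow> ip x + ip y \<notin> H"
    and idem_absorb: "\<And>i j x. \<lbrakk>i \<in> H; j \<in> H; x \<in> F; ip x \<notin> H; i + j + ip x \<in> H\<rbrakk>
      \<Longrightarrow> i + ip x \<in> H \<or> j + ip x \<in> H"
begin

text \<open>Testing the prime itself agrees with testing its class in C_n': if
  \<open>ip (prime_el p)\<close> is in H, then \<open>good (prime_el p)\<close> and
  \<open>good (prime_el p + N)\<close> are equivalent, by \<open>good_if_H\<close> and because
  \<open>N\<close> is in H.\<close>

definition weight :: "'p \<Rightarrow> nat" where
  "weight p = (if ip (prime_el p) \<notin> H then 0 else if good (prime_el p) then 2 else 1)"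

lemma weight_eq_0_iff: "weight p = 0 \<longleftrightarrow> ip (prime_el p) \<notin> H"
  by (simp add: weight_def)

definition mweight :: "'p multiset \<Rightarrow> nat" where
  "mweight M = sum_mset (image_mset weight M)"

lemma mweight_simps [simp]: "mweight {#} = 0" "mweight (add_mset p M) = weight p + mweight M"
  "mweight (A + B) = mweight A + mweight B"
  by (simp_all add: mweight_def)

lemma add_mset_eq_prime_el: "(0, add_mset p M) = prime_el p + (0, M)"
  by (simp add: prime_el_def)

lemma pure_in_F [simp]: "(0, M) \<in> F \<longleftrightarrow> set_mset M \<subseteq> P"
  by (simp add: Fset_def)

text \<open>By (P1), being good after adding \<open>N\<close> is the kernel condition of a
  homomorphism into a group of order two.\<close>

lemma good_add_N_iff:
  assumes "x \<in> F" "y \<in> F"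
  shows "good (x + y + N) \<longleftrightarrow> (good (x + N) \<longleftrightarrow> good (y + N))"
proof -
  have "good (x + y + N)" if "good (x + N)" "good (y + N)"
    using good_add[OF that] good_eqv[OF eqv_add_N[of "x + N" x "y + N" y]] assms by simp
  moreover have "good (y + N)" if "good (x + y + N)" "good (x + N)"
    using good_add_N_cancel that assms by blast
  moreover have "good (x + N)" if "good (x + y + N)" "good (y + N)"
    using good_add_N_cancel[of y x] that assms by (simp add: add.commute)
  ultimately show ?thesis
    using index_two assms by blast
qed

text \<open>Parity of the weight records the class in C_n'. The even weight 0 fits because (P2)
  makes primes with idempotent outside H trivial there.\<close>

lemma even_weight_iff:
  assumes "p \<in> P" shows "even (weight p) \<longleftrightarrow> good (prime_el p + N)"
  using assms good_if_H[of "prime_el p"] good_if_not_H[of "prime_el p"]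
    good_add[OF _ good_H[OF N_in_H], of "prime_el p"]
  by (auto simp: weight_def)

lemma even_mweight_iff:
  "set_mset M \<subseteq> P \<Longrightarrow> even (mweight M) \<longleftrightarrow> good ((0, M) + N)"
proof (induction M)
  case empty
  then show ?case
    using good_H[OF N_in_H] by (simp flip: zero_prod_def)
next
  case (add p M)
  then have "good (prime_el p + (0, M) + N) \<longleftrightarrow> (good (prime_el p + N) \<longleftrightarrow> good ((0, M) + N))"
    by (intro good_add_N_iff) auto
  then show ?case
    using add even_weight_iff[of p] by (simp add: add_mset_eq_prime_el)
qed

lemma ip_in_H_multiset:
  "\<lbrakk>set_mset M \<subseteq> P; \<forall>p\<in>#M. ip (prime_el p) \<in> H\<rbrakk> \<Longrightarrow> ip (0, M) \<in> H"
proof (induction M)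
  case empty
  then show ?case
    using ip_in_H[OF zero_in_H] by (simp add: zero_prod_def)
next
  case (add p M)
  then show ?case
    by (simp add: add_mset_eq_prime_el ip_add add_in_H)
qed

lemma ip_notin_H_multiset:
  "\<lbrakk>set_mset M \<subseteq> P; M \<noteq> {#}; \<forall>p\<in>#M. ip (prime_el p) \<notin> H\<rbrakk> \<Longrightarrow> ip (0, M) \<notin> H"
proof (induction M)
  case (add p M)
  show ?case
  proof (cases "M = {#}")
    case True
    then show ?thesis
      using add by (simp add: prime_el_def)
  next
    case False
    then show ?thesis
      using add idem_closed[of "prime_el p" "(0, M)"] by (simp add: add_mset_eq_prime_el ip_add)
  qed
qed simp

text \<open>The nonzero weights are 1 and 2, so either one prime of weight 2 or two primes of weight
  1 will do.\<close>

lemma split_off_weight_two: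
  assumes "\<forall>p\<in>#M. weight p \<noteq> 0" "mweight M \<ge> 2"
  obtains A B where "M = A + B" "mweight A = 2"
proof (cases "\<exists>p\<in>#M. weight p = 2")
  case True
  then obtain p where "p \<in># M" "weight p = 2" by blast
  then show ?thesis
    using that[of "{#p#}" "M - {#p#}"] by simp
next
  case False
  then have one: "weight p = 1" if "p \<in># M" for p
    using assms(1) that by (auto simp: weight_def split: if_splits)
  obtain p M' where M': "M = add_mset p M'"
    using assms(2) by (cases M) auto
  with assms(2) one obtain q M'' where "M' = add_mset q M''"
    by (cases M') auto
  then show ?thesis
    using that[of "{#p, q#}" M''] M' one by simp
qed

text \<open>The weight is even by (P1) and (P2), and positive since otherwise (P4) would keep the
  idempotent outside H. From weight 4 on the element splits, so only 2 remains.\<close>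

lemma atom_weight:
  assumes "atom H x" shows "mweight (snd x) = 2"
proof -
  define M where "M = snd x"
  have x: "x \<in> H" "M \<noteq> {#}" "x = unit_el (fst x) + (0, M)"
    using assms by (auto simp: atom_iff M_def unit_el_def)
  have MP: "set_mset M \<subseteq> P"
    using H_in_F[OF x(1)] by (simp add: Fset_def M_def)
  have good_M: "good (0, M)"
    unfolding good_def using x by metis
  have "even (mweight M)"
    using even_mweight_iff[OF MP] good_add[OF good_M good_H[OF N_in_H]] by simp
  moreover have ip_M: "ip (0, M) \<in> H"
    using good_ip_in_H good_M MP by simp
  moreover have "mweight M \<noteq> 0"
  proof
    assume "mweight M = 0"
    then have "\<forall>p\<in>#M. ip (prime_el p) \<notin> H"
      by (auto simp: mweight_def weight_eq_0_iff)
    then show False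
      using ip_notin_H_multiset MP x(2) ip_M by blast
  qed
  moreover have "\<not> mweight M \<ge> 4"
  proof
    assume ge: "mweight M \<ge> 4"
    define M0 where "M0 = filter_mset (\<lambda>p. ip (prime_el p) \<notin> H) M"
    define M1 where "M1 = filter_mset (\<lambda>p. ip (prime_el p) \<in> H) M"
    have M: "M = M1 + M0"
      unfolding M0_def M1_def by (rule multiset_partition)
    have w0: "mweight M0 = 0"
      by (auto simp: M0_def mweight_def weight_def)
    have "\<forall>p\<in>#M1. weight p \<noteq> 0" "mweight M1 \<ge> 2"
      using ge w0 unfolding M by (auto simp: M1_def weight_def)
    \<comment> \<open>Removing weight exactly 2 leaves an even weight of at least 2. The primes of
      weight 0 are kept aside in \<open>M0\<close> until it is known which part can take
      them.\<close>
    then obtain A B where AB: "M1 = A + B" "mweight A = 2"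
      by (rule split_off_weight_two)
    have AB_P: "set_mset A \<subseteq> P" "set_mset B \<subseteq> P" "set_mset M0 \<subseteq> P"
      using MP unfolding M AB by auto
    have "\<forall>p\<in>#M1. ip (prime_el p) \<in> H"
      by (simp add: M1_def)
    then have ip_AB: "ip (0, A) \<in> H" "ip (0, B) \<in> H"
      using AB_P unfolding AB by (auto intro!: ip_in_H_multiset)
    have wB: "even (mweight B)" "mweight B \<ge> 2"
      using \<open>even (mweight M)\<close> ge AB(2) w0 unfolding M AB(1) by auto
    \<comment> \<open>Even weight and an idempotent in H make both parts good by (P2); (P3) then
      shares out the remaining unit so that both factors lie in H, which contradicts the
      atom.\<close>
    have split_False: False
      if M: "M = A' + B'" and wA: "even (mweight A')" "mweight A' \<ge> 2" "ip (0, A') \<in> H"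
        and wB: "even (mweight B')" "mweight B' \<ge> 2" "ip (0, B') \<in> H" for A' B'
    proof -
      have P: "set_mset A' \<subseteq> P" "set_mset B' \<subseteq> P"
        using MP M by auto
      have "good (0, A')" "good (0, B')"
        using good_if_H[of "(0, A')"] good_if_H[of "(0, B')"] even_mweight_iff[OF P(1)]
          even_mweight_iff[OF P(2)] wA wB P by auto
      then obtain a b where ab: "unit_el a + (0, A') \<in> H" "unit_el b + (0, B') \<in> H"
        by (auto simp: good_def)
      \<comment> \<open>What is left of the unit of \<open>x\<close> after each part has received
        the unit that brings it into H.\<close>
      have "unit_el (fst x - a - b) + (unit_el a + (0, A')) + (unit_el b + (0, B')) = x"
        using x(3) unfolding M by (auto simp: unit_el_def prod_eq_iff)
      then obtain v where v: "unit_el v + (unit_el a + (0, A')) \<in> H"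
        "unit_el (fst x - a - b - v) + (unit_el b + (0, B')) \<in> H"
        using kernels[OF ab, of "fst x - a - b"] x(1) by auto
      have "x = (unit_el v + (unit_el a + (0, A'))) + (unit_el (fst x - a - b - v) + (unit_el b + (0, B')))"
        using x(3) unfolding M by (auto simp: unit_el_def prod_eq_iff)
      then have "A' = {#} \<or> B' = {#}"
        using assms v unfolding atom_iff by (fastforce simp: unit_el_def)
      then show False
        using wA wB by auto
    qed
    show False
    proof (cases "M0 = {#}")
      case True
      then show ?thesis
        using split_False[of A B] AB(2) wB ip_AB by (simp add: M AB(1))
    next
      case False
      moreover have "\<forall>p\<in>#M0. ip (prime_el p) \<notin> H"
        by (simp add: M0_def)
      ultimately have "ip (0, M0) \<notin> H"
        using ip_notin_H_multiset[OF AB_P(3)] by blast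
      moreover have "(0 :: 'u, M) = (0, A) + (0, B) + (0, M0)"
        by (simp add: M AB(1))
      then have "ip (0, A) + ip (0, B) + ip (0, M0) \<in> H"
        using ip_M by (simp only: ip_add)
      \<comment> \<open>(P4) decides which of the two parts takes the primes of weight 0.\<close>
      ultimately have "ip (0, A) + ip (0, M0) \<in> H \<or> ip (0, B) + ip (0, M0) \<in> H"
        using idem_absorb[OF ip_AB, of "(0, M0)"] AB_P by simp
      then have "ip (0, A + M0) \<in> H \<or> ip (0, B + M0) \<in> H"
        using ip_add[of "(0, A)" "(0, M0)"] ip_add[of "(0, B)" "(0, M0)"] by simp
      then show ?thesis
        using split_False[of "A + M0" B] split_False[of A "B + M0"] AB(2) wB ip_AB w0
        by (auto simp: M AB(1) ac_simps)
    qed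
  qed
  ultimately have "mweight M = 2" by presburger
  then show ?thesis by (simp add: M_def)
qed

text \<open>The weight is additive, so every factorization into atoms has half the weight of the
  product as its length.\<close>

lemma half_factorial_if: "half_factorial H"
proof -
  have *: "mweight (snd (sum_list xs)) = 2 * length xs" if "\<forall>x\<in>set xs. atom H x" for xs
    using that by (induction xs) (auto simp: atom_weight)
  show ?thesis
    unfolding half_factorial_def fprod_eq_sum_list using * by (metis mult_left_cancel zero_neq_numeral)
qed

end

section \<open>(P2) and (P1) through representatives\<close>

lemma preimage_phiImg_iff:
  assumes i: "i + i \<approx> i"
  shows "{g \<in> constituent P H (ClassSG P H) (cls P H i). cplus P H g (cls P H N) \<in> phiImg P H (cls P H N)}
      = (if cls P H i \<in> CH P H then phiImg P H (cls P H i) else constituent P H (ClassSG P H) (cls P H i))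
    \<longleftrightarrow> (\<forall>x\<in>F. ip x \<approx> i \<longrightarrow> (if i \<in> H then good (x + N) \<longrightarrow> good x else good (x + N)))"
    (is "?S = ?T \<longleftrightarrow> ?rhs")
proof -
  note N = N_in_F N_in_H
  have iF: "i \<in> F"
    using eqv_in_F(2)[OF i] .
  have good_N: "cls P H (x + N) \<in> phiImg P H (cls P H N) \<longleftrightarrow> good (x + N)" if "x \<in> F" for x
  proof (rule cls_in_phiImg_iff)
    have "ip (x + N) \<approx> ip x + N"
      unfolding ip_add using that by (intro eqv_add_left ip_of_idem N_idem) auto
    then show "ip (x + N) \<approx> N"
      using eqv_trans ip_add_N[OF that] by blast
  qed (use that N in auto)
  have S: "?S = cls P H ` {x \<in> F. ip x \<approx> i \<and> good (x + N)}"
    unfolding constituent_eq[OF i] using good_N N(1) by (auto simp: cplus_cls)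
  have T: "?T = cls P H ` {x \<in> F. ip x \<approx> i \<and> (i \<in> H \<longrightarrow> good x)}"
  proof (cases "i \<in> H")
    case True
    then show ?thesis
      using phiImg_subset_constituent[OF i] cls_in_phiImg_iff[OF True] iF
      by (auto simp: cls_in_CH_iff)
  next
    case False
    then show ?thesis
      by (simp add: cls_in_CH_iff iF constituent_eq[OF i])
  qed
  \<comment> \<open>A condition invariant under equivalence may be tested on any representative,
    which turns equality of sets of classes into a statement about elements of F.\<close>
  have mem: "cls P H x \<in> cls P H ` {x \<in> F. ip x \<approx> i \<and> Q x} \<longleftrightarrow> ip x \<approx> i \<and> Q x"
    if x: "x \<in> F" and Q: "\<And>y z. y \<approx> z \<Longrightarrow> Q y \<Longrightarrow> Q z" for x Q
  proof
    assume "cls P H x \<in> cls P H ` {x \<in> F. ip x \<approx> i \<and> Q x}"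
    then obtain y where "y \<in> F" "cls P H x = cls P H y" "ip y \<approx> i" "Q y" by blast
    then have y: "x \<approx> y" "ip y \<approx> i" "Q y"
      using x by (simp_all add: cls_eq_iff)
    then show "ip x \<approx> i \<and> Q x"
      using eqv_trans[OF eqv_ip[OF y(1)] y(2)] Q[OF eqv_sym[OF y(1)] y(3)] by simp
  qed (use x in auto)
  have "?S = ?T \<longleftrightarrow> (\<forall>x\<in>F. cls P H x \<in> ?S \<longleftrightarrow> cls P H x \<in> ?T)"
    unfolding S T by blast
  also have "\<dots> \<longleftrightarrow> (\<forall>x\<in>F. ip x \<approx> i \<and> good (x + N) \<longleftrightarrow> ip x \<approx> i \<and> (i \<in> H \<longrightarrow> good x))"
  proof (intro ball_cong refl)
    fix x assume x: "x \<in> F"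
    have "cls P H x \<in> ?S \<longleftrightarrow> ip x \<approx> i \<and> good (x + N)"
      unfolding S by (rule mem[OF x]) (use good_eqv eqv_add_right N(1) in blast)
    moreover have "cls P H x \<in> ?T \<longleftrightarrow> ip x \<approx> i \<and> (i \<in> H \<longrightarrow> good x)"
      unfolding T by (rule mem[OF x]) (use good_eqv in blast)
    ultimately show "(cls P H x \<in> ?S \<longleftrightarrow> cls P H x \<in> ?T) \<longleftrightarrow>
        (ip x \<approx> i \<and> good (x + N) \<longleftrightarrow> ip x \<approx> i \<and> (i \<in> H \<longrightarrow> good x))" by simp
  qed
  \<comment> \<open>As \<open>N\<close> is in H, goodness always passes from \<open>x\<close> to
    \<open>x + N\<close>; for \<open>i\<close> in H only the converse implication remains.\<close>
  also have "\<dots> \<longleftrightarrow> ?rhs"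
    using good_add[OF _ good_H[OF N(2)]] by auto
  finally show ?thesis .
qed

text \<open>A group has order at most 2 exactly when any two nontrivial elements have trivial
  sum.\<close>

lemma card_quotient_iff:
  "card ((\<lambda>g. (\<lambda>h. cplus P H g h) ` phiImg P H (cls P H N)) ` constituent P H (ClassSG P H) (cls P H N)) \<le> 2
    \<longleftrightarrow> (\<forall>x\<in>F. \<forall>y\<in>F. \<not> good (x + N) \<longrightarrow> \<not> good (y + N) \<longrightarrow> good (x + y + N))"
proof -
  note N = N_in_F N_in_H
  \<comment> \<open>Adding \<open>N\<close> sends every element of F into the group of
    \<open>N\<close>, so the cosets can be indexed by all of F.\<close>
  define coset where "coset x = range (\<lambda>u. cls P H (unit_el u + (x + N)))" for x
  have coset: "(\<lambda>h. cplus P H (cls P H x) h) ` phiImg P H (cls P H N) = coset x" if "x \<in> F" for x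
    using that N(1) by (simp add: coset_def phiImg_eq image_image cplus_cls ac_simps)
  have const: "constituent P H (ClassSG P H) (cls P H N) = (\<lambda>x. cls P H (x + N)) ` F"
  proof -
    have "cls P H x = cls P H (x + N)" if "x \<in> F" "ip x \<approx> N" for x
      using that ip_eqv_iff[OF N_idem that(1)] N(1) eqv_sym by (simp add: cls_eq_iff)
    moreover have "ip (x + N) \<approx> N" if "x \<in> F" for x
      using eqv_trans[OF eqv_add_left[OF ip_of_idem[OF N_idem], of "ip x"] ip_add_N[OF that]] that
      by (simp add: ip_add)
    ultimately show ?thesis
      unfolding constituent_eq[OF N_idem] using N(1) by fastforce
  qed
  have coset_N: "coset (x + N) = coset x" if "x \<in> F" for x
  proof -
    have "unit_el u + (x + N + N) \<approx> unit_el u + (x + N)" for u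
      using eqv_add_left[OF N_idem, of "unit_el u + x"] that by (simp add: add.assoc)
    then have "cls P H (unit_el u + (x + N + N)) = cls P H (unit_el u + (x + N))" for u
      using that N(1) by (simp add: cls_eq_iff)
    then show ?thesis
      unfolding coset_def by simp
  qed
  define Q where "Q = coset ` F"
  have Q: "(\<lambda>g. (\<lambda>h. cplus P H g h) ` phiImg P H (cls P H N)) ` constituent P H (ClassSG P H) (cls P H N) = Q"
    unfolding const image_image Q_def using N(1) by (intro image_cong) (auto simp: coset coset_N)
  have coset_eq: "coset x = coset y \<longleftrightarrow> (\<exists>u. unit_el u + (x + N) \<approx> y + N)" if xy: "x \<in> F" "y \<in> F" for x y
  proof
    assume "coset x = coset y"
    moreover have "cls P H (y + N) \<in> coset y"
      unfolding coset_def by (rule range_eqI[of _ _ 0]) simp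
    ultimately have "cls P H (y + N) \<in> coset x" by simp
    then obtain u where "y + N \<approx> unit_el u + (x + N)"
      using xy N(1) by (auto simp: coset_def cls_eq_iff)
    then show "\<exists>u. unit_el u + (x + N) \<approx> y + N"
      using eqv_sym by blast
  next
    assume "\<exists>u. unit_el u + (x + N) \<approx> y + N"
    then obtain u where u: "unit_el u + (x + N) \<approx> y + N" by blast
    have "unit_el v + (y + N) \<approx> unit_el (v + u) + (x + N)" for v
      using eqv_add_left[OF eqv_sym[OF u], of "unit_el v"] by (simp add: unit_el_add add.assoc)
    then have 1: "cls P H (unit_el v + (y + N)) = cls P H (unit_el (v + u) + (x + N))" for v
      using xy N(1) by (simp add: cls_eq_iff)
    have 2: "cls P H (unit_el v + (x + N)) = cls P H (unit_el (v - u) + (y + N))" for v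
      using 1[of "v - u"] by simp
    show "coset x = coset y"
      unfolding coset_def using 1 2 by blast
  qed
  have triv: "coset x = coset N \<longleftrightarrow> good (x + N)" if x: "x \<in> F" for x
  proof -
    have "coset x = coset N \<longleftrightarrow> (\<exists>u. unit_el u + (x + N) \<approx> N)"
      using coset_eq[OF x N(1)] eqv_trans[OF _ N_idem] eqv_trans[OF _ eqv_sym[OF N_idem]] by blast
    also have "\<dots> \<longleftrightarrow> good (x + N)"
    proof
      assume "good (x + N)"
      then obtain u where u: "unit_el u + (x + N) \<in> H" by (auto simp: good_def)
      have "unit_el u + (x + N) \<approx> ip x + ip N"
        using unit_add_eqv_ip[OF _ u] x N(1) by (simp add: ip_add)
      also have "\<dots> \<approx> ip x + N"
        using x by (intro eqv_add_left ip_of_idem N_idem) auto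
      also have "\<dots> \<approx> N"
        using x by (rule ip_add_N)
      finally show "\<exists>u. unit_el u + (x + N) \<approx> N" by blast
    next
      assume "\<exists>u. unit_el u + (x + N) \<approx> N"
      then show "good (x + N)"
        using N(2) eqv_H unfolding good_def by blast
    qed
    finally show ?thesis .
  qed
  \<comment> \<open>In the quotient \<open>nv x\<close> is the inverse of \<open>x\<close>, so
    equality with \<open>y\<close> means that \<open>x + y\<close> is trivial.\<close>
  have pair: "coset (nv x) = coset y \<longleftrightarrow> good (x + y + N)" if x: "x \<in> F" and y: "y \<in> F" for x y
  proof -
    have iN: "ip x + (y + N) \<approx> y + N" and ipN: "ip x + N \<approx> N"
      using ip_add_add_N[OF x y] ip_add_N[OF x] by auto
    have "(\<exists>u. unit_el u + (nv x + N) \<approx> y + N) \<longleftrightarrow> (\<exists>u. unit_el u + N \<approx> x + y + N)"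
    proof (intro iff_exI iffI)
      fix u assume "unit_el u + (nv x + N) \<approx> y + N"
      then have "x + (unit_el u + (nv x + N)) \<approx> x + (y + N)"
        using x by (rule eqv_add_left)
      then have 1: "unit_el u + (ip x + N) \<approx> x + y + N"
        by (simp add: ac_simps flip: add_nv)
      show "unit_el u + N \<approx> x + y + N"
        using eqv_trans[OF eqv_add_left[OF eqv_sym[OF ipN]] 1] by simp
    next
      fix u assume "unit_el u + N \<approx> x + y + N"
      then have "nv x + (unit_el u + N) \<approx> nv x + (x + y + N)"
        using x by (intro eqv_add_left) auto
      then have 1: "unit_el u + (nv x + N) \<approx> ip x + (y + N)"
        by (simp add: ac_simps flip: add_nv)
      show "unit_el u + (nv x + N) \<approx> y + N"
        using eqv_trans[OF 1 iN] .
    qed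
    moreover have "\<dots> \<longleftrightarrow> coset N = coset (x + y)"
    proof -
      have "unit_el u + (N + N) \<approx> unit_el u + N" for u
        using N_idem by (intro eqv_add_left) auto
      then show ?thesis
        using coset_eq[OF N(1), of "x + y"] x y eqv_trans eqv_sym by (metis add_in_F)
    qed
    ultimately show ?thesis
      using coset_eq[of "nv x" y] x y triv[of "x + y"] by auto
  qed
  \<comment> \<open>An infinite set has \<open>card\<close> 0, so finiteness is what gives the bound
    its meaning.\<close>
  have finQ: "finite Q"
    unfolding Q[symmetric] using finite_ClassSG by (simp add: constituent_def)
  have cN: "coset N \<in> Q"
    using N(1) by (simp add: Q_def)
  \<comment> \<open>Removing the trivial coset turns the bound into uniqueness of the nontrivial
    one.\<close>
  have "card Q \<le> 2 \<longleftrightarrow> card (Q - {coset N}) \<le> 1"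
    using card.remove[OF finQ cN] by simp
  also have "\<dots> \<longleftrightarrow> (\<forall>a\<in>Q - {coset N}. \<forall>b\<in>Q - {coset N}. a = b)"
    using card_le_Suc0_iff_eq[of "Q - {coset N}"] finQ by simp
  also have "\<dots> \<longleftrightarrow> (\<forall>x\<in>F. \<forall>y\<in>F. \<not> good (x + N) \<longrightarrow> \<not> good (y + N) \<longrightarrow> coset x = coset y)"
    using triv by (simp add: Q_def ball_Diff_single cong: ball_cong)
  also have "\<dots> \<longleftrightarrow> (\<forall>x\<in>F. \<forall>y\<in>F. \<not> good (x + N) \<longrightarrow> \<not> good (y + N) \<longrightarrow> good (x + y + N))"
    (is "?A \<longleftrightarrow> ?B")
  proof
    assume A: ?A
    show ?B
    proof (intro ballI impI)
      fix x y assume xy: "x \<in> F" "y \<in> F" "\<not> good (x + N)" "\<not> good (y + N)"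
      then have "coset (nv x) = coset y"
        using A good_nv_N[OF xy(1)] nv_in_F[OF xy(1)] by blast
      then show "good (x + y + N)"
        using pair xy by blast
    qed
  next
    assume B: ?B
    show ?A
    proof (intro ballI impI)
      fix x y assume xy: "x \<in> F" "y \<in> F" "\<not> good (x + N)" "\<not> good (y + N)"
      \<comment> \<open>Taking \<open>x\<close> twice shows that its coset is its own
        inverse.\<close>
      then have "coset (nv x) = coset x" "coset (nv x) = coset y"
        using B pair by blast+
      then show "coset x = coset y" by simp
    qed
  qed
  finally show ?thesis
    unfolding Q .
qed

section \<open>The equivalence for representatives\<close>

lemma half_factorial_iff:
  "half_factorial H \<longleftrightarrow>
    (\<forall>x\<in>F. \<forall>y\<in>F. \<not> good (x + N) \<longrightarrow> \<not> good (y + N) \<longrightarrow> good (x + y + N)) \<and>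
    (\<forall>x\<in>F. if ip x \<in> H then good (x + N) \<longrightarrow> good x else good (x + N)) \<and>
    (\<forall>i\<in>H. \<forall>j\<in>H. \<forall>u. unit_el u + i + j \<in> H \<longrightarrow>
      (\<exists>v. unit_el v + i \<in> H \<and> unit_el (u - v) + j \<in> H)) \<and>
    (\<forall>x\<in>F. \<forall>y\<in>F. ip x \<notin> H \<longrightarrow> ip y \<notin> H \<longrightarrow> ip x + ip y \<notin> H) \<and>
    (\<forall>i\<in>H. \<forall>j\<in>H. \<forall>x\<in>F. ip x \<notin> H \<longrightarrow> i + j + ip x \<in> H \<longrightarrow> i + ip x \<in> H \<or> j + ip x \<in> H)"
    (is "_ \<longleftrightarrow> ?A \<and> ?B \<and> ?C \<and> ?D \<and> ?E")
proof
  assume hf: "half_factorial H"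
  have ?A
    using half_factorial_index_two[OF hf] by blast
  moreover have ?B
    using half_factorial_good_if_H[OF hf]
      half_factorial_good_if_not_H[OF hf] by simp
  moreover have ?C
    using half_factorial_kernels[OF hf] by blast
  moreover have ?D
    using half_factorial_idem_closed[OF hf] by blast
  moreover have ?E
    using half_factorial_idem_absorb[OF hf] by blast
  ultimately show "?A \<and> ?B \<and> ?C \<and> ?D \<and> ?E" by blast
next
  assume conds: "?A \<and> ?B \<and> ?C \<and> ?D \<and> ?E"
  then have B: ?B by blast
  show "half_factorial H"
  proof (rule half_factorial_if)
    show "good (x + y + N)" if "x \<in> F" "y \<in> F" "\<not> good (x + N)" "\<not> good (y + N)" for x y
      using conds that by blast
    show "good x" if "x \<in> F" "ip x \<in> H" "good (x + N)" for x
      using B that by auto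
    show "good (x + N)" if "x \<in> F" "ip x \<notin> H" for x
      using B that by auto
    show "\<exists>v. unit_el v + i \<in> H \<and> unit_el (u - v) + j \<in> H"
      if "i \<in> H" "j \<in> H" "unit_el u + i + j \<in> H" for i j u
      using conds that by blast
    show "ip x + ip y \<notin> H" if "x \<in> F" "ip x \<notin> H" "y \<in> F" "ip y \<notin> H" for x y
      using conds that by blast
    show "i + ip x \<in> H \<or> j + ip x \<in> H"
      if "i \<in> H" "j \<in> H" "x \<in> F" "ip x \<notin> H" "i + j + ip x \<in> H" for i j x
      using conds that by blast
  qed
qed

end

end

section \<open>Translation to the enumerated idempotents\<close>

theorem theorem4p2:
  fixes P :: "'p set" and H :: "('u::ab_group_add, 'p) fm set"
    and e :: "nat \<Rightarrow> ('u,'p) fm set" and n :: nat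
  assumes "submonoid P H"
    and "seminormal H"
    and "C_monoid P H"
    and "munits H = H \<inter> Funits"
    and "dense P H"
    and "inj_on e {0..n}"
    and "idem P H (ClassSG P H) = e ` {0..n}"
    and "idem P H (RedClassSG P H) = e ` {0..n}"
    and "e 0 = cls P H fone"
    and "csum P H e n = e n"
    and "\<forall>c\<in>RedClassSG P H. \<exists>p\<in>P. prime_el p \<in> c"
  shows "half_factorial H \<longleftrightarrow>
    ( \<comment> \<open>(P1)\<close>
      card ((\<lambda>g. (\<lambda>h. cplus P H g h) ` phiImg P H (e n))
              ` constituent P H (RedClassSG P H) (e n)) \<le> 2
    \<and> \<comment> \<open>(P2)\<close>
      (\<forall>i\<in>{0..n}.
         {g \<in> constituent P H (RedClassSG P H) (e i). cplus P H g (e n) \<in> phiImg P H (e n)}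
         = (if e i \<in> CH P H then phiImg P H (e i) else constituent P H (ClassSG P H) (e i)))
    \<and> \<comment> \<open>(P3)\<close>
      (\<forall>i\<in>{0..n}. \<forall>j\<in>{0..n}. i \<noteq> j \<and> e i \<in> CH P H \<and> e j \<in> CH P H \<longrightarrow>
         {g \<in> CFu P H. cplus P H (cplus P H g (e i)) (e j) = cplus P H (e i) (e j)}
         = {cplus P H a b | a b. a \<in> phiKer P H (e i) \<and> b \<in> phiKer P H (e j)})
    \<and> \<comment> \<open>(P4)\<close>
      (\<forall>a\<in>idem P H (RedClassSG P H) - CH P H. \<forall>b\<in>idem P H (RedClassSG P H) - CH P H.
         cplus P H a b \<in> idem P H (RedClassSG P H) - CH P H)
    \<and> (\<forall>i1\<in>{0..n}. \<forall>i2\<in>{0..n}. \<forall>j\<in>{0..n}.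
         i1 \<noteq> i2 \<and> i1 \<noteq> j \<and> i2 \<noteq> j \<and> e i1 \<in> CH P H \<and> e i2 \<in> CH P H
         \<and> e j \<in> idem P H (RedClassSG P H) - CH P H
         \<and> cplus P H (cplus P H (e i1) (e i2)) (e j) \<in> CH P H
         \<longrightarrow> cplus P H (e i1) (e j) \<in> CH P H \<or> cplus P H (e i2) (e j) \<in> CH P H))"
proof -
  interpret C_monoid_with_primes P H
    by unfold_locales (use assms in auto)
  have idem_e: "\<exists>x. x + x \<approx> x \<and> e i = cls P H x" if "i \<in> {0..n}" for i
    using assms(7) that idem_ClassSG_iff[of "e i"] by blast
  have e_idem: "\<exists>i\<in>{0..n}. e i = cls P H x" if "x + x \<approx> x" for x
    using assms(7) that idem_ClassSG_iff[of "cls P H x"] by (metis imageE)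
  obtain N where N: "N + N \<approx> N" "e n = cls P H N"
    using idem_e[of n] by auto
  have NF: "N \<in> F"
    using eqv_in_F(2)[OF N(1)] .
  have ipN: "\<forall>x\<in>F. ip x + N \<approx> N"
  proof
    fix x assume x: "x \<in> F"
    obtain i where i: "i \<in> {0..n}" "e i = cls P H (ip x)"
      using e_idem[OF ip_idem[OF x]] by blast
    \<comment> \<open>The sum of all idempotents absorbs each of them, and it equals
      \<open>e n\<close>.\<close>
    have "cplus P H (e i) (csum P H e n) = csum P H e n"
      by (rule csum_absorbs) (use assms(7) i in auto)
    then show "ip x + N \<approx> N"
      using i(2) N(2) NF x by (simp add: assms(10) cplus_cls cls_eq_iff)
  qed
  have e_of_H: "\<exists>k\<in>{0..n}. e k = cls P H i" if "i \<in> H" for i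
    using e_idem[OF H_idem[OF that]] .
  have CH_e: "\<exists>x\<in>H. e i = cls P H x" if i: "e i \<in> CH P H" for i
    using i by (auto simp: CH_def)
  have P2: "(\<forall>i\<in>{0..n}.
         {g \<in> constituent P H (RedClassSG P H) (e i). cplus P H g (e n) \<in> phiImg P H (e n)}
         = (if e i \<in> CH P H then phiImg P H (e i) else constituent P H (ClassSG P H) (e i)))
    \<longleftrightarrow> (\<forall>x\<in>F. if ip x \<in> H then good (x + N) \<longrightarrow> good x else good (x + N))" (is "?L \<longleftrightarrow> ?R")
  proof
    assume L: ?L
    show ?R
    proof
      fix x assume x: "x \<in> F"
      \<comment> \<open>The index of the constituent group that contains the class of
        \<open>x\<close>.\<close>
      obtain i where i: "i \<in> {0..n}" "e i = cls P H (ip x)"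
        using e_idem[OF ip_idem[OF x]] by blast
      have "\<forall>y\<in>F. ip y \<approx> ip x \<longrightarrow> (if ip x \<in> H then good (y + N) \<longrightarrow> good y else good (y + N))"
        using bspec[OF L i(1)]
        unfolding RedClassSG_eq N(2) i(2) preimage_phiImg_iff[OF N(1) ipN ip_idem[OF x]] .
      then show "if ip x \<in> H then good (x + N) \<longrightarrow> good x else good (x + N)"
        using x eqv_refl[OF ip_in_F[OF x]] by blast
    qed
  next
    assume R: ?R
    show ?L
    proof
      fix i assume "i \<in> {0..n}"
      then obtain r where r: "r + r \<approx> r" "e i = cls P H r"
        using idem_e by blast
      have "\<forall>x\<in>F. ip x \<approx> r \<longrightarrow> (if r \<in> H then good (x + N) \<longrightarrow> good x else good (x + N))"
      proof (intro ballI impI)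
        fix x assume x: "x \<in> F" "ip x \<approx> r"
        show "if r \<in> H then good (x + N) \<longrightarrow> good x else good (x + N)"
          using bspec[OF R x(1)] unfolding eqv_H[OF x(2)] .
      qed
      then show "{g \<in> constituent P H (RedClassSG P H) (e i). cplus P H g (e n) \<in> phiImg P H (e n)}
         = (if e i \<in> CH P H then phiImg P H (e i) else constituent P H (ClassSG P H) (e i))"
        unfolding RedClassSG_eq N(2) r(2) preimage_phiImg_iff[OF N(1) ipN r(1)] .
    qed
  qed
  have P3: "(\<forall>i\<in>{0..n}. \<forall>j\<in>{0..n}. i \<noteq> j \<and> e i \<in> CH P H \<and> e j \<in> CH P H \<longrightarrow>
         {g \<in> CFu P H. cplus P H (cplus P H g (e i)) (e j) = cplus P H (e i) (e j)}
         = {cplus P H a b | a b. a \<in> phiKer P H (e i) \<and> b \<in> phiKer P H (e j)})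
    \<longleftrightarrow> (\<forall>i\<in>H. \<forall>j\<in>H. \<forall>u. unit_el u + i + j \<in> H \<longrightarrow>
      (\<exists>v. unit_el v + i \<in> H \<and> unit_el (u - v) + j \<in> H))" (is "?L \<longleftrightarrow> ?R")
  proof
    assume L: ?L
    show ?R
    proof (intro ballI allI impI)
      fix i j u assume ij: "i \<in> H" "j \<in> H" and u: "unit_el u + i + j \<in> H"
      obtain k l where kl: "k \<in> {0..n}" "l \<in> {0..n}" "e k = cls P H i" "e l = cls P H j"
        using e_of_H ij by metis
      show "\<exists>v. unit_el v + i \<in> H \<and> unit_el (u - v) + j \<in> H"
      proof (cases "k = l")
        \<comment> \<open>For equal indices \<open>i + j\<close> collapses to \<open>j\<close>, so
          the whole unit \<open>u\<close> goes to \<open>j\<close> and \<open>v = 0\<close>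
          works.\<close>
        case True
        then have "i \<approx> j"
          using kl ij cls_eq_iff[of i j] by simp
        then have "i + j \<approx> j"
          using ij(2) by (rule eqv_add_absorb)
        then have "unit_el u + (i + j) \<approx> unit_el u + j"
          by (intro eqv_add_left) auto
        then have "unit_el u + j \<in> H"
          using u eqv_H by (simp add: add.assoc)
        then show ?thesis
          using ij by (intro exI[of _ 0]) simp
      next
        case False
        have CH: "cls P H i \<in> CH P H" "cls P H j \<in> CH P H"
          using ij by (auto simp: CH_def)
        show ?thesis
          using L[rule_format, OF kl(1,2)] False CH kernel_sum_iff[OF ij] u unfolding kl(3,4) by blast
      qed
    qed
  next
    assume R: ?R
    show ?L
    proof (intro ballI impI)
      fix k l assume "k \<noteq> l \<and> e k \<in> CH P H \<and> e l \<in> CH P H"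
      then obtain i j where ij: "i \<in> H" "j \<in> H" "e k = cls P H i" "e l = cls P H j"
        using CH_e by metis
      show "{g \<in> CFu P H. cplus P H (cplus P H g (e k)) (e l) = cplus P H (e k) (e l)}
         = {cplus P H a b | a b. a \<in> phiKer P H (e k) \<and> b \<in> phiKer P H (e l)}"
        unfolding ij(3,4) kernel_sum_iff[OF ij(1,2)] using R ij by blast
    qed
  qed
  have non_CH: "\<exists>x\<in>F. ip x \<notin> H \<and> c = cls P H (ip x)"
    if c: "c \<in> idem P H (ClassSG P H) - CH P H" for c
  proof -
    obtain x where x: "x + x \<approx> x" "c = cls P H x"
      using c idem_ClassSG_iff[of c] by blast
    have "x \<in> F" "ip x \<approx> x"
      using eqv_in_F(2)[OF x(1)] ip_of_idem[OF x(1)] by auto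
    then show ?thesis
      using c x cls_in_CH_iff[of x] cls_eq_iff[of "ip x" x] eqv_H[of "ip x" x] by auto
  qed
  have ip_non_CH: "cls P H (ip x) \<in> idem P H (ClassSG P H) - CH P H" if "x \<in> F" "ip x \<notin> H" for x
    using idem_ClassSG_iff[of "cls P H (ip x)"] ip_idem[OF that(1)] that(2)
      cls_in_CH_iff[OF ip_in_F[OF that(1)]] by blast
  have P4: "(\<forall>a\<in>idem P H (RedClassSG P H) - CH P H. \<forall>b\<in>idem P H (RedClassSG P H) - CH P H.
         cplus P H a b \<in> idem P H (RedClassSG P H) - CH P H)
    \<longleftrightarrow> (\<forall>x\<in>F. \<forall>y\<in>F. ip x \<notin> H \<longrightarrow> ip y \<notin> H \<longrightarrow> ip x + ip y \<notin> H)" (is "?L \<longleftrightarrow> ?R")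
  proof
    assume L: ?L
    show ?R
    proof (intro ballI impI)
      fix x y assume xy: "x \<in> F" "y \<in> F" "ip x \<notin> H" "ip y \<notin> H"
      then have "cplus P H (cls P H (ip x)) (cls P H (ip y)) \<notin> CH P H"
        using L ip_non_CH unfolding RedClassSG_eq by blast
      then show "ip x + ip y \<notin> H"
        using xy by (simp add: cplus_cls cls_in_CH_iff)
    qed
  next
    assume R: ?R
    show ?L
      unfolding RedClassSG_eq
    proof (intro ballI)
      fix a b assume ab: "a \<in> idem P H (ClassSG P H) - CH P H" "b \<in> idem P H (ClassSG P H) - CH P H"
      obtain x where x: "x \<in> F" "ip x \<notin> H" "a = cls P H (ip x)"
        using non_CH[OF ab(1)] by blast
      obtain y where y: "y \<in> F" "ip y \<notin> H" "b = cls P H (ip y)"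
        using non_CH[OF ab(2)] by blast
      have "ip (x + y) \<notin> H"
        using R x y by (simp add: ip_add)
      then show "cplus P H a b \<in> idem P H (ClassSG P H) - CH P H"
        using ip_non_CH[of "x + y"] x y by (simp add: cplus_cls ip_add)
    qed
  qed
  have P4': "(\<forall>i1\<in>{0..n}. \<forall>i2\<in>{0..n}. \<forall>j\<in>{0..n}.
         i1 \<noteq> i2 \<and> i1 \<noteq> j \<and> i2 \<noteq> j \<and> e i1 \<in> CH P H \<and> e i2 \<in> CH P H
         \<and> e j \<in> idem P H (RedClassSG P H) - CH P H
         \<and> cplus P H (cplus P H (e i1) (e i2)) (e j) \<in> CH P H
         \<longrightarrow> cplus P H (e i1) (e j) \<in> CH P H \<or> cplus P H (e i2) (e j) \<in> CH P H)
    \<longleftrightarrow> (\<forall>i\<in>H. \<forall>j\<in>H. \<forall>x\<in>F. ip x \<notin> H \<longrightarrow> i + j + ip x \<in> H \<longrightarrow> i + ip x \<in> H \<or> j + ip x \<in> H)"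
    (is "?L \<longleftrightarrow> ?R")
  proof
    assume L: ?L
    show ?R
    proof (intro ballI impI)
      fix i j x assume ij: "i \<in> H" "j \<in> H" and x: "x \<in> F" "ip x \<notin> H" and sum: "i + j + ip x \<in> H"
      obtain k l where kl: "k \<in> {0..n}" "l \<in> {0..n}" "e k = cls P H i" "e l = cls P H j"
        using e_of_H ij by metis
      obtain m where m: "m \<in> {0..n}" "e m = cls P H (ip x)"
        using e_idem[OF ip_idem[OF x(1)]] by blast
      have CH: "e k \<in> CH P H" "e l \<in> CH P H" "e m \<in> idem P H (RedClassSG P H) - CH P H"
        using ij ip_non_CH[OF x] by (auto simp: kl m CH_def RedClassSG_eq)
      show "i + ip x \<in> H \<or> j + ip x \<in> H"
      proof (cases "k = l")
        \<comment> \<open>For equal indices \<open>i + j\<close> collapses to \<open>j\<close>, and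
          the assumption already puts \<open>j + ip x\<close> into H.\<close>
        case True
        then have "i \<approx> j"
          using kl ij cls_eq_iff[of i j] by simp
        then have "i + j \<approx> j"
          using ij(2) by (rule eqv_add_absorb)
        then have "i + j + ip x \<approx> j + ip x"
          using x by (intro eqv_add_right) auto
        then show ?thesis
          using sum eqv_H by blast
      next
        case False
        \<comment> \<open>The class \<open>e m\<close> lies outside \<open>CH P H\<close>, unlike
          the other two.\<close>
        have "k \<noteq> m" "l \<noteq> m"
          using CH by auto
        moreover have "cplus P H (cplus P H (e k) (e l)) (e m) \<in> CH P H"
          using ij x sum by (simp add: kl m cplus_cls cls_in_CH_iff)
        ultimately have "cplus P H (e k) (e m) \<in> CH P H \<or> cplus P H (e l) (e m) \<in> CH P H"
          using L kl m CH False by blast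
        then show ?thesis
          using ij x by (simp add: kl m cplus_cls cls_in_CH_iff)
      qed
    qed
  next
    assume R: ?R
    show ?L
    proof (intro ballI impI, elim conjE)
      fix k l m assume CH: "e k \<in> CH P H" "e l \<in> CH P H" "e m \<in> idem P H (RedClassSG P H) - CH P H"
        and sum: "cplus P H (cplus P H (e k) (e l)) (e m) \<in> CH P H"
      obtain i j where ij: "i \<in> H" "j \<in> H" "e k = cls P H i" "e l = cls P H j"
        using CH_e CH by metis
      obtain x where x: "x \<in> F" "ip x \<notin> H" "e m = cls P H (ip x)"
        using non_CH[of "e m"] CH(3) unfolding RedClassSG_eq by blast
      have "i + j + ip x \<in> H"
        using sum ij x by (simp add: cplus_cls cls_in_CH_iff)
      then have "i + ip x \<in> H \<or> j + ip x \<in> H"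
        using R ij x by blast
      then show "cplus P H (e k) (e m) \<in> CH P H \<or> cplus P H (e l) (e m) \<in> CH P H"
        using ij x by (simp add: cplus_cls cls_in_CH_iff)
    qed
  qed
  show ?thesis
    unfolding P2 P3 P4 P4' using half_factorial_iff[OF N(1) ipN] card_quotient_iff[OF N(1) ipN]
    by (simp only: RedClassSG_eq N(2))
qed

end
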